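(* Let $\delta\in[0,1)$, let $\sigma\in\mathcal M([-1,1])$, and let $\mu$ be the invariant measure of the homogeneous affine I.F.S. with contraction ratio $\delta$ and affine constants distribution $\sigma$. Then the Jacobi matrix $J_\mu$ can be computed recursively from $\delta$ and the Jacobi matrix $J_\sigma$. Moreover, for every $\bar n\ge1$, the computation of the truncation $J_\mu^{(\bar n)}$ only requires knowledge of ($\delta$ and) $J_\sigma^{(\bar n)}$; that is, there is a recursive procedure which, given $\delta$ and $J^{(\bar n)}_\sigma$ as input, outputs $J^{(\bar n)}_{\mu}$.
   Context: $\mathcal M([-1,1])$ is the set of positive Borel probability measures on $\mathbf R$ with support contained in $[-1,1]$. For $\delta\in[0,1)$ put $\bar\delta:=1-\delta$ and $\phi(\beta,s):=\delta s+\bar\delta\beta$. The invariant measure of the affine homogeneous I.F.S. $(\delta,\sigma)$ (with contraction ratio $\delta$ and affine constants distribution $\sigma$) is the unique probability measure $\mu$ satisfying $\int f(s)\,d\mu(s)=\int d\sigma(\beta)\int d\mu(s)\,f(\phi(\beta,s))$ for every continuous function $f$. For a compactly supported probability measure $\nu$ on $\mathbf R$, $p_n(\nu;s)$ denotes the orthonormal polynomial of degree $n$ (positive leading coefficient), satisfying $s\,p_n(\nu;s)=b_{n+1}(\nu)p_{n+1}(\nu;s)+a_n(\nu)p_n(\nu;s)+b_n(\nu)p_{n-1}(\nu;s)$, with $b_0(\nu)=0$, $p_{-1}=0$, $p_0=1$. The Jacobi matrix $J_\nu$ is the symmetric tridiagonal matrix with diagonal $a_0(\nu),a_1(\nu),\dots$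 and off-diagonal $b_1(\nu),b_2(\nu),\dots$; $J_\nu^{(\bar n)}$ is its leading $\bar n\times\bar n$ truncation. If the support of $\nu$ consists of exactly $M<\infty$ points, $J_\nu$ is the $M\times M$ matrix with entries $a_0,\dots,a_{M-1}$, $b_1,\dots,b_{M-1}$ (and one sets $b_j(\nu)=0$ for $j\ge M$), and $J_\nu^{(\bar n)}:=J_\nu$ for $\bar n\ge M$. "Computed recursively" means: the entries $a_0,b_1,a_1,b_2,\dots$ of the output matrix are generated successively, in order of increasing index, each by finitely many real arithmetic operations, square roots and tests for zero applied to the input data and previously computed quantities. *)

theory Defs
  imports
    "HOL-Probability.Probability"
    "HOL-Computational_Algebra.Polynomial"
    "HOL-Library.Extended_Nat"
begin

section \<open>Measures and invariant measures\<close>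

definition supp :: "real measure \<Rightarrow> real set" where
  "supp \<nu> = {x. \<forall>U. open U \<longrightarrow> x \<in> U \<longrightarrow> emeasure \<nu> U > 0}"

definition supp_card :: "real measure \<Rightarrow> enat" where
  "supp_card \<nu> = (if finite (supp \<nu>) then enat (card (supp \<nu>)) else \<infinity>)"

definition prob_measures_on :: "real set \<Rightarrow> real measure set" where
  "prob_measures_on K = {\<nu>. prob_space \<nu> \<and> sets \<nu> = sets borel \<and> supp \<nu> \<subseteq> K}"

definition ifs_map :: "real \<Rightarrow> real \<Rightarrow> real \<Rightarrow> real" where
  "ifs_map \<delta> \<beta> s = \<delta> * s + (1 - \<delta>) * \<beta>"

definition ifs_invariant :: "real \<Rightarrow> real measure \<Rightarrow> real measure \<Rightarrow> bool" where
  "ifs_invariant \<delta> \<sigma> \<mu> \<longleftrightarrow>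
     prob_space \<mu> \<and> sets \<mu> = sets borel \<and>
     (\<forall>f :: real \<Rightarrow> real. continuous_on UNIV f \<longrightarrow>
        (LINT s|\<mu>. f s) = (LINT \<beta>|\<sigma>. (LINT s|\<mu>. f (ifs_map \<delta> \<beta> s))))"


section \<open>Orthonormal polynomials and Jacobi matrices\<close>

text \<open>Meaningful for degrees below the number of points of the support; beyond that no such
  polynomial exists.\<close>

definition orthonormal_poly :: "real measure \<Rightarrow> nat \<Rightarrow> real poly" where
  "orthonormal_poly \<nu> n =
     (THE p. degree p = n \<and> lead_coeff p > 0 \<and>
        (\<forall>q. degree q < n \<longrightarrow> (LINT s|\<nu>. poly p s * poly q s) = 0) \<and>
        (LINT s|\<nu>. (poly p s)\<^sup>2) = 1)"

text \<open>The recurrence is imposed on the support of the measure. If the support is infinite this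
  is the same as an identity of polynomials. If the support has exactly \<open>M\<close> points, it is an
  identity of polynomials for \<open>n < M - 1\<close>, while for \<open>n = M - 1\<close> it is an identity in
  the \<open>M\<close>-dimensional space of functions on the support, with \<open>b M = 0\<close>. Since
  \<open>b 0 = 0\<close>, the value of the polynomial of index \<open>0 - 1\<close> is irrelevant. The
  coefficients \<open>a j\<close> with \<open>j \<ge> M\<close>, which belong to no Jacobi matrix, are set
  to zero.\<close>

definition is_recurrence_coeffs :: "real measure \<Rightarrow> (nat \<Rightarrow> real) \<Rightarrow> (nat \<Rightarrow> real) \<Rightarrow> bool" where
  "is_recurrence_coeffs \<nu> a b \<longleftrightarrow>
     b 0 = 0 \<and>
     (\<forall>n. enat n < supp_card \<nu> \<longrightarrow> (\<forall>s\<in>supp \<nu>.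
        s * poly (orthonormal_poly \<nu> n) s =
          b (n + 1) * poly (orthonormal_poly \<nu> (n + 1)) s
          + a n * poly (orthonormal_poly \<nu> n) s
          + b n * poly (orthonormal_poly \<nu> (n - 1)) s)) \<and>
     (\<forall>j. supp_card \<nu> \<le> enat j \<longrightarrow> a j = 0 \<and> b j = 0)"

definition recurrence_coeffs :: "real measure \<Rightarrow> (nat \<Rightarrow> real) \<times> (nat \<Rightarrow> real)" where
  "recurrence_coeffs \<nu> = (THE ab. is_recurrence_coeffs \<nu> (fst ab) (snd ab))"

definition jacobi_a :: "real measure \<Rightarrow> nat \<Rightarrow> real" where
  "jacobi_a \<nu> = fst (recurrence_coeffs \<nu>)"

definition jacobi_b :: "real measure \<Rightarrow> nat \<Rightarrow> real" where
  "jacobi_b \<nu> = snd (recurrence_coeffs \<nu>)"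

text \<open>Square matrices of finite or countably infinite size, with rows and columns numbered from
  zero. The matrices built below have entry zero outside their index range, so that a truncation
  carries no trace of the discarded entries.\<close>

record sq_matrix =
  msize :: enat
  mentry :: "nat \<Rightarrow> nat \<Rightarrow> real"

definition jacobi_matrix :: "real measure \<Rightarrow> sq_matrix" where
  "jacobi_matrix \<nu> =
     \<lparr> msize = supp_card \<nu>,
       mentry = (\<lambda>i j.
         if enat i < supp_card \<nu> \<and> enat j < supp_card \<nu> then
           (if i = j then jacobi_a \<nu> i
            else if i = j + 1 then jacobi_b \<nu> i
            else if j = i + 1 then jacobi_b \<nu> j
            else 0)
         else 0) \<rparr>"

definition truncate_matrix :: "nat \<Rightarrow> sq_matrix \<Rightarrow> sq_matrix" where
  "truncate_matrix n A =
     \<lparr> msize = min (enat n) (msize A),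
       mentry = (\<lambda>i j. if i < n \<and> j < n then mentry A i j else 0) \<rparr>"


section \<open>Recursive procedures over the reals\<close>

text \<open>A real random access machine. Natural number registers serve for counting and indexing only;
  real memory cells are addressed by triples of natural numbers. The real operations are the four
  arithmetic operations and the square root, the only real constants are 0 and 1, and the only
  test on real numbers is the test for zero. The input is read-only: a real parameter
  \<open>\<delta>\<close> and the entries of a matrix. (The size \<open>m\<close> of a finite Jacobi
  matrix need not be supplied: with the zero padding above it is the least \<open>m \<ge> 1\<close>
  such that entry \<open>(m, m - 1)\<close> vanishes.)

  Division by zero and square roots of negative numbers follow the HOL conventions
  \<open>x / 0 = 0\<close> and \<open>sqrt (- x) = - sqrt x\<close>. This adds no power, since a program
  can test a divisor for zero, and \<open>x \<ge> 0\<close> amounts to \<open>sqrt (x * x) - x\<close>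
  being zero.\<close>

datatype nexp =
    NConst nat
  | NReg nat
  | NAdd nexp nexp
  | NSub nexp nexp
  | NMul nexp nexp

datatype rexp =
    RZero
  | ROne
  | RParam
  | REntry nexp nexp
  | RCell nexp nexp nexp
  | RAdd rexp rexp
  | RSub rexp rexp
  | RMul rexp rexp
  | RDiv rexp rexp
  | RSqrt rexp

datatype bexp =
    IsZero rexp
  | NLess nexp nexp
  | BNot bexp
  | BAnd bexp bexp

datatype com =
    Skip
  | SetReg nat nexp
  | SetCell nexp nexp nexp rexp
  | Emit rexp
  | Seq com com
  | Cond bexp com com
  | While bexp com

record state =
  regs :: "nat \<Rightarrow> nat"
  cells :: "nat \<Rightarrow> nat \<Rightarrow> nat \<Rightarrow> real"
  outputs :: "real list"

fun nval :: "nexp \<Rightarrow> state \<Rightarrow> nat" where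
  "nval (NConst k) s = k"
| "nval (NReg r) s = regs s r"
| "nval (NAdd e f) s = nval e s + nval f s"
| "nval (NSub e f) s = nval e s - nval f s"
| "nval (NMul e f) s = nval e s * nval f s"

fun rval :: "real \<Rightarrow> sq_matrix \<Rightarrow> rexp \<Rightarrow> state \<Rightarrow> real" where
  "rval \<delta> A RZero s = 0"
| "rval \<delta> A ROne s = 1"
| "rval \<delta> A RParam s = \<delta>"
| "rval \<delta> A (REntry i j) s = mentry A (nval i s) (nval j s)"
| "rval \<delta> A (RCell i j k) s = cells s (nval i s) (nval j s) (nval k s)"
| "rval \<delta> A (RAdd e f) s = rval \<delta> A e s + rval \<delta> A f s"
| "rval \<delta> A (RSub e f) s = rval \<delta> A e s - rval \<delta> A f s"
| "rval \<delta> A (RMul e f) s = rval \<delta> A e s * rval \<delta> A f s"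
| "rval \<delta> A (RDiv e f) s = rval \<delta> A e s / rval \<delta> A f s"
| "rval \<delta> A (RSqrt e) s = sqrt (rval \<delta> A e s)"

fun bval :: "real \<Rightarrow> sq_matrix \<Rightarrow> bexp \<Rightarrow> state \<Rightarrow> bool" where
  "bval \<delta> A (IsZero e) s = (rval \<delta> A e s = 0)"
| "bval \<delta> A (NLess e f) s = (nval e s < nval f s)"
| "bval \<delta> A (BNot b) s = (\<not> bval \<delta> A b s)"
| "bval \<delta> A (BAnd b c) s = (bval \<delta> A b s \<and> bval \<delta> A c s)"

fun step :: "real \<Rightarrow> sq_matrix \<Rightarrow> com \<times> state \<Rightarrow> com \<times> state" where
  "step \<delta> A (Skip, s) = (Skip, s)"
| "step \<delta> A (SetReg r e, s) = (Skip, s\<lparr>regs := (regs s)(r := nval e s)\<rparr>)"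
| "step \<delta> A (SetCell i j k e, s) =
     (Skip, s\<lparr>cells := (\<lambda>i' j' k'.
        if i' = nval i s \<and> j' = nval j s \<and> k' = nval k s then rval \<delta> A e s
        else cells s i' j' k')\<rparr>)"
| "step \<delta> A (Emit e, s) = (Skip, s\<lparr>outputs := outputs s @ [rval \<delta> A e s]\<rparr>)"
| "step \<delta> A (Seq c d, s) =
     (if c = Skip then (d, s) else (case step \<delta> A (c, s) of (c', s') \<Rightarrow> (Seq c' d, s')))"
| "step \<delta> A (Cond b c d, s) = (if bval \<delta> A b s then c else d, s)"
| "step \<delta> A (While b c, s) = (if bval \<delta> A b s then Seq c (While b c) else Skip, s)"

text \<open>The natural number \<open>n\<close> is an additional discrete input, found in register 0 at
  the start; everything else is initially zero.\<close>

definition init_state :: "nat \<Rightarrow> state" where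
  "init_state n =
     \<lparr> regs = (\<lambda>r. if r = 0 then n else 0), cells = (\<lambda>i j k. 0), outputs = [] \<rparr>"

definition run :: "com \<Rightarrow> nat \<Rightarrow> real \<Rightarrow> sq_matrix \<Rightarrow> nat \<Rightarrow> com \<times> state" where
  "run P n \<delta> A t = (step \<delta> A ^^ t) (P, init_state n)"

text \<open>The entries of a Jacobi matrix in the order
  \<open>a 0, b 1, a 1, b 2, \<dots>\<close>, that is, the positions
  \<open>(0, 0), (1, 0), (1, 1), (2, 1), \<dots>\<close>.\<close>

definition jacobi_entry :: "sq_matrix \<Rightarrow> nat \<Rightarrow> real" where
  "jacobi_entry A k = mentry A ((k + 1) div 2) (k div 2)"

text \<open>A finite matrix of size \<open>m\<close> has to be output completely, whereupon the program
  halts, so that the length \<open>2 * m - 1\<close> of the output reveals the size. For an infinite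
  matrix the program runs forever and every finite initial part of the sequence of entries is
  output after finitely many steps.\<close>

definition outputs_matrix :: "com \<Rightarrow> nat \<Rightarrow> real \<Rightarrow> sq_matrix \<Rightarrow> sq_matrix \<Rightarrow> bool" where
  "outputs_matrix P n \<delta> A B \<longleftrightarrow>
     (case msize B of
        enat m \<Rightarrow> \<exists>t. fst (run P n \<delta> A t) = Skip \<and>
                  outputs (snd (run P n \<delta> A t)) = map (jacobi_entry B) [0..<2 * m - 1]
      | \<infinity> \<Rightarrow> \<forall>k. \<exists>t. outputs (snd (run P n \<delta> A t)) = map (jacobi_entry B) [0..<k])"

end

theory Submission
  imports Defs
begin

text \<open>
  The proof passes through moments. In the basis of orthonormal polynomials the Jacobi matrix of
  \<open>\<sigma>\<close> represents the multiplication by \<open>s\<close>, so the moment of order \<open>l\<close>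
  of \<open>\<sigma>\<close> is the corner entry of the \<open>l\<close>-th power of this matrix
  (\<open>moment_krylov\<close>). Because the matrix is tridiagonal, a walk of length \<open>l < 2 * n\<close>
  from index 0 back to index 0 never uses an entry outside the truncation of size \<open>n\<close>
  (\<open>krylov_truncate\<close>): the truncation determines the moments of order below
  \<open>2 * n\<close>.

  Inserting the monomial of degree \<open>L\<close> into the invariance equation expresses the moment of
  order \<open>L\<close> of \<open>\<mu>\<close> through the moments of \<open>\<sigma>\<close> up to order \<open>L\<close>, the
  moments of \<open>\<mu>\<close> of lower order, and \<open>\<delta> ^ L\<close> times itself. Since
  \<open>\<delta> < 1\<close>, the equation can be solved (\<open>moment_triangle_top\<close>). That the monomials
  are integrable is a consequence of the contraction, which confines \<open>\<mu>\<close> to the unit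
  interval (\<open>supp_mu\<close>).

  The moments of \<open>\<mu>\<close> finally give its Jacobi matrix by the Chebyshev algorithm
  (\<open>op_moment_rec\<close>, \<open>mdiag_eq\<close>), which tabulates the integrals of the monic
  orthogonal polynomials \<open>\<pi>\<^sub>k\<close> against monomials. The coefficients of index up to
  \<open>n - 1\<close> need the moments of order up to \<open>2 * n - 1\<close>, which is exactly what the
  truncation supplies. If the support of \<open>\<mu>\<close> has \<open>m\<close> points, then \<open>\<pi>\<^sub>m\<close>
  vanishes on it, and \<open>m\<close> is the first index at which the squared norm of
  \<open>\<pi>\<^sub>k\<close> is zero (\<open>mnorm_pos\<close>, \<open>mnorm_eq_0\<close>); a test for zero therefore
  tells when to stop.

  Each of these three steps is a recurrence that fills a triangular table, and the machine program
  consists of loops that evaluate them (\<open>wp_fill\<close>). Round \<open>k\<close> of its main loop emits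
  the coefficients of index \<open>k\<close> (\<open>wp_one_round_continue\<close>). The two programs asked for
  differ only in the guard of the main loop.
\<close>

section \<open>Probability measures supported in the unit interval\<close>

text \<open>The complement of the support is a union of open null sets, and by the Lindelof property
  countably many of them suffice.\<close>

lemma AE_in_supp:
  assumes "sets \<nu> = sets borel"
  shows "AE x in \<nu>. x \<in> supp \<nu>"
proof -
  define \<F> where "\<F> = {U :: real set. open U \<and> emeasure \<nu> U = 0}"
  obtain \<G> where G: "\<G> \<subseteq> \<F>" "countable \<G>" "\<Union>\<G> = \<Union>\<F>"
    using Lindelof[of \<F>] by (auto simp: \<F>_def)
  have "(\<Union>U\<in>\<G>. U) \<in> null_sets \<nu>"
    using G assms by (intro null_sets_UN') (auto simp: \<F>_def null_sets_def)
  moreover have "x \<in> \<Union>\<F>" if "x \<notin> supp \<nu>" for x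
    using that by (auto simp: supp_def \<F>_def zero_less_iff_neq_zero)
  ultimately show ?thesis
    using G by (intro AE_I'[where N = "\<Union>\<G>"]) auto
qed

locale unit_measure = prob_space \<nu> for \<nu> :: "real measure" +
  assumes sets_borel: "sets \<nu> = sets borel"
    and supp_le: "supp \<nu> \<subseteq> {-1..1}"
begin

lemma AE_abs_le: "AE x in \<nu>. \<bar>x\<bar> \<le> 1"
  using AE_in_supp[OF sets_borel] by eventually_elim (use supp_le in \<open>auto simp: abs_le_iff\<close>)

lemma integrable_continuous:
  fixes f :: "real \<Rightarrow> real"
  assumes "continuous_on UNIV f"
  shows "integrable \<nu> f"
proof -
  have "compact (f ` {-1..1})"
    by (intro compact_continuous_image continuous_on_subset[OF assms]) auto
  then obtain B where "\<forall>y \<in> f ` {-1..1}. norm y \<le> B"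
    using compact_imp_bounded bounded_iff by metis
  moreover have "f \<in> borel_measurable \<nu>"
    using borel_measurable_continuous_onI[OF assms] sets_borel
    by (simp cong: measurable_cong_sets)
  moreover have "AE x in \<nu>. norm (f x) \<le> B"
    using AE_abs_le by eventually_elim (use calculation in \<open>auto simp: abs_le_iff\<close>)
  ultimately show ?thesis
    by (intro integrable_const_bound[where B = B])
qed

text \<open>All moment arguments take place in the space of polynomials with the bilinear form
  \<open>mean (p * q)\<close>, so the integral is used only through this linear functional.\<close>

definition mean :: "real poly \<Rightarrow> real" where
  "mean p = (LINT s|\<nu>. poly p s)"

lemma integrable_poly [simp]: "integrable \<nu> (poly p)"
  by (intro integrable_continuous continuous_intros)

lemma mean_add [simp]: "mean (p + q) = mean p + mean q"
  by (simp add: mean_def)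

lemma mean_diff [simp]: "mean (p - q) = mean p - mean q"
  by (simp add: mean_def)

lemma mean_smult [simp]: "mean (smult c p) = c * mean p"
  by (simp add: mean_def)

lemma mean_0 [simp]: "mean 0 = 0"
  by (simp add: mean_def)

lemma mean_1 [simp]: "mean 1 = 1"
  by (simp add: mean_def prob_space)

text \<open>For a finite support, identities such as the last recurrence relation hold only between
  functions on the support; this is what allows them to be integrated nevertheless.\<close>

lemma mean_cong_supp:
  assumes "\<And>x. x \<in> supp \<nu> \<Longrightarrow> poly p x = poly q x"
  shows "mean p = mean q"
proof -
  have "AE x in \<nu>. poly p x = poly q x"
    using AE_in_supp[OF sets_borel] by eventually_elim (use assms in auto)
  then show ?thesis
    unfolding mean_def
    by (intro integral_cong_AE) (use integrable_poly in \<open>auto intro: borel_measurable_integrable\<close>)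
qed

lemma mean_square_nonneg: "mean (p * p) \<ge> 0"
  by (simp add: mean_def)

text \<open>If \<open>p\<close> did not vanish at a point of the support, it would be nonzero on an open
  neighbourhood of this point, which has positive measure.\<close>

lemma mean_square_eq_0D:
  assumes "mean (p * p) = 0" "x \<in> supp \<nu>"
  shows "poly p x = 0"
proof (rule ccontr)
  assume nz: "poly p x \<noteq> 0"
  define U where "U = {y. poly p y \<noteq> 0}"
  have "open U"
    unfolding U_def by (intro open_Collect_neq continuous_intros)
  then have pos: "emeasure \<nu> U > 0"
    using assms(2) nz by (auto simp: supp_def U_def)
  have "AE y in \<nu>. poly (p * p) y = 0"
    using assms(1) integral_nonneg_eq_0_iff_AE[OF integrable_poly[of "p * p"]]
        unfolding mean_def by auto
  then have "AE y in \<nu>. y \<notin> U"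
    by eventually_elim (auto simp: U_def)
  moreover have "U \<in> sets \<nu>"
    using \<open>open U\<close> sets_borel by auto
  ultimately have "emeasure \<nu> U = 0"
    using AE_iff_measurable[of U \<nu> "\<lambda>y. y \<notin> U"] sets.sets_into_space by fastforce
  with pos show False by simp
qed

text \<open>The form is definite in degrees below the number of support points, because a nonzero
  polynomial has no more zeros than its degree. This is the reason why exactly the degrees
  \<open>n < supp_card \<nu>\<close> carry an orthonormal polynomial.\<close>

lemma mean_square_pos:
  assumes "p \<noteq> 0" "enat (degree p) < supp_card \<nu>"
  shows "mean (p * p) > 0"
proof (rule ccontr)
  assume "\<not> mean (p * p) > 0"
  then have "mean (p * p) = 0"
    using mean_square_nonneg[of p] by simp
  then have sub: "supp \<nu> \<subseteq> {x. poly p x = 0}"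
    using mean_square_eq_0D by blast
  have "finite {x. poly p x = 0}"
    using assms(1) poly_roots_finite by blast
  then have "finite (supp \<nu>)" "card (supp \<nu>) \<le> degree p"
    using sub assms(1) finite_subset card_mono card_poly_roots_bound order_trans by metis+
  then show False
    using assms(2) by (simp add: supp_card_def)
qed

lemma supp_card_pos: "0 < supp_card \<nu>"
proof -
  have "supp \<nu> \<noteq> {}"
  proof
    assume "supp \<nu> = {}"
    then have "AE x in \<nu>. False"
      using AE_in_supp[OF sets_borel] by simp
    then show False by simp
  qed
  then show ?thesis
    by (auto simp: supp_card_def zero_enat_def[symmetric] card_gt_0_iff)
        (simp add: enat_0_iff zero_less_iff_neq_zero)
qed

end

section \<open>Monic orthogonal polynomials\<close>

text \<open>The condition \<open>degree q < k\<close>, corrected at \<open>k = 0\<close>, where only the zero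
  polynomial is meant: the zero polynomial has degree 0.\<close>

definition poly_below :: "nat \<Rightarrow> 'a::zero poly \<Rightarrow> bool" where
  "poly_below k q \<longleftrightarrow> (\<forall>i\<ge>k. coeff q i = 0)"

lemma poly_below_iff_degree: "0 < k \<Longrightarrow> poly_below k q \<longleftrightarrow> degree q < k"
  unfolding poly_below_def
  by (metis coeff_eq_0 leading_coeff_0_iff degree_0 linorder_not_le order_less_le_trans)

lemma poly_below_0 [simp]: "poly_below 0 q \<longleftrightarrow> q = 0"
  by (auto simp: poly_below_def poly_eq_iff)

text \<open>One step of division by a monic polynomial removes the leading term.\<close>

lemma poly_below_reduce:
  fixes q m :: "real poly"
  assumes "poly_below (Suc k) q" "degree m = k" "lead_coeff m = 1"
  shows "poly_below k (q - smult (coeff q k) m)"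
  unfolding poly_below_def
proof (intro allI impI)
  fix i assume "k \<le> i"
  then show "coeff (q - smult (coeff q k) m) i = 0"
    using assms by (cases "i = k") (auto simp: poly_below_def coeff_eq_0)
qed

context unit_measure
begin

text \<open>The monic orthogonal polynomials \<open>\<pi>\<^sub>k\<close> (Stieltjes procedure), with the index
  shifted by one: \<open>mop (Suc k)\<close> is \<open>\<pi>\<^sub>k\<close> and \<open>mop 0\<close> stands for
  \<open>\<pi>\<close> of index \<open>-1\<close>. The shift lets the three-term recurrence start without a
  special case, since quotients with denominator
  \<open>mean (mop 0 * mop 0) = 0\<close> are zero.\<close>

fun mop :: "nat \<Rightarrow> real poly" where
  "mop 0 = 0"
| "mop (Suc 0) = 1"
| "mop (Suc (Suc r)) =
     pCons 0 (mop (Suc r))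
     - smult (mean (pCons 0 (mop (Suc r)) * mop (Suc r)) / mean (mop (Suc r) * mop (Suc r))) (mop (Suc r))
     - smult (mean (mop (Suc r) * mop (Suc r)) / mean (mop r * mop r)) (mop r)"

definition mdiag :: "nat \<Rightarrow> real" where
  "mdiag k = mean (pCons 0 (mop (Suc k)) * mop (Suc k)) / mean (mop (Suc k) * mop (Suc k))"

definition mnorm :: "nat \<Rightarrow> real" where
  "mnorm k = mean (mop k * mop k)"

lemma mop_rec: "pCons 0 (mop (Suc r))
    = mop (Suc (Suc r)) + smult (mdiag r) (mop (Suc r)) + smult (mnorm (Suc r) / mnorm r) (mop r)"
  by (simp add: mdiag_def mnorm_def)

declare mop.simps(3) [simp del]

lemma mnorm_0 [simp]: "mnorm 0 = 0" and mnorm_1 [simp]: "mnorm (Suc 0) = 1"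
  by (simp_all add: mnorm_def)

lemma mop_monic: "degree (mop (Suc k)) = k \<and> coeff (mop (Suc k)) k = 1"
proof (induction k rule: less_induct)
  case (less k)
  show ?case
  proof (cases k)
    case 0
    then show ?thesis by simp
  next
    case (Suc r)
    have eq: "mop (Suc k)
        = pCons 0 (mop (Suc r)) - smult (mdiag r) (mop (Suc r))
            - smult (mnorm (Suc r) / mnorm r) (mop r)"
      using mop_rec[of r] Suc by (simp add: algebra_simps)
    have r: "degree (mop (Suc r)) = r" "coeff (mop (Suc r)) r = 1"
      using less[of r] Suc by auto
    have r0: "coeff (mop r) i = 0" if "i \<ge> r" for i
      using less[of "r - 1"] Suc that by (cases r) (auto intro: coeff_eq_0)
    have "coeff (mop (Suc k)) i = 0" if "i > k" for i
      unfolding eq using that Suc r r0[of i] by (auto simp: coeff_pCons coeff_eq_0 split: nat.split)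
    then have "degree (mop (Suc k)) \<le> k"
      by (intro degree_le) auto
    moreover have "coeff (mop (Suc k)) k = 1"
      unfolding eq using r r0[of k] Suc by (auto simp: coeff_eq_0)
    ultimately show ?thesis
      by (metis le_antisym le_degree zero_neq_one)
  qed
qed

lemma degree_mop [simp]: "degree (mop (Suc k)) = k"
  and lead_mop [simp]: "coeff (mop (Suc k)) k = 1"
  using mop_monic by auto

lemma mop_nz [simp]: "mop (Suc k) \<noteq> 0"
  using lead_mop[of k] by (metis coeff_0 zero_neq_one)

lemma mnorm_pos: "enat k < supp_card \<nu> \<Longrightarrow> mnorm (Suc k) > 0"
  unfolding mnorm_def by (intro mean_square_pos) auto

lemma mop_below: "poly_below k (mop k)"
  by (cases k) (auto simp: poly_below_def coeff_eq_0)

text \<open>Subtracting a multiple of \<open>\<pi>\<^sub>k\<close> from \<open>q\<close> leaves a polynomial of smaller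
  degree, on which the orthogonality applies.\<close>

lemma mop_orth_step:
  assumes orth: "\<And>q. poly_below k q \<Longrightarrow> mean (mop (Suc k) * q) = 0"
  assumes q: "poly_below (Suc k) q"
  shows "mean (mop (Suc k) * q) = coeff q k * mnorm (Suc k)"
proof -
  have "mean (mop (Suc k) * (q - smult (coeff q k) (mop (Suc k)))) = 0"
    by (intro orth poly_below_reduce q) auto
  then show ?thesis
    by (simp add: algebra_simps mnorm_def)
qed

text \<open>In \<open>\<pi>\<^sub>k = s \<pi>\<^sub>r - \<dots>\<close> (with \<open>k = r + 1\<close>) the multiplication by \<open>s\<close> is
  moved to the other factor. Writing the latter as \<open>t + c \<pi>\<^sub>r\<close> with \<open>t\<close> of
  degree below \<open>r\<close>, the two correction terms of the recurrence cancel precisely the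
  contributions of the leading coefficients of \<open>c \<pi>\<^sub>r\<close> and of \<open>t\<close>. The argument
  divides by the norms of lower index, which are positive up to and including
  \<open>k = supp_card \<nu>\<close>.\<close>

lemma mop_orth:
  assumes "enat k \<le> supp_card \<nu>" "poly_below k q"
  shows "mean (mop (Suc k) * q) = 0"
  using assms
proof (induction k arbitrary: q rule: less_induct)
  case (less k)
  show ?case
  proof (cases k)
    case 0
    then show ?thesis using less by simp
  next
    case (Suc r)
    have lt: "enat r < supp_card \<nu>"
      using less(2) Suc by (metis Suc_ile_eq)
    have h: "mnorm (Suc r) > 0" by (rule mnorm_pos[OF lt])
    note orth = less(1)[of r, simplified Suc, simplified, OF less_imp_le[OF lt]]
    define c where "c = coeff q r"
    define t where "t = q - smult c (mop (Suc r))"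
    have t: "poly_below r t"
      unfolding t_def c_def using less(3) Suc by (intro poly_below_reduce) auto
    have qt: "q = t + smult c (mop (Suc r))"
      by (simp add: t_def)
    have "poly_below (Suc r) (pCons 0 t)"
      using t by (auto simp: poly_below_def coeff_pCons split: nat.split)
    from mop_orth_step[OF orth this] have 1: "mean (mop (Suc r) * pCons 0 t)
        = coeff (pCons 0 t) r * mnorm (Suc r)"
      by simp
    have 2: "mean (mop (Suc r) * q) = c * mnorm (Suc r)"
      using mop_orth_step[OF orth, of q] less(3) Suc by (simp add: c_def)
    have 3: "mnorm (Suc r) / mnorm r * mean (mop r * q) = coeff (pCons 0 t) r * mnorm (Suc r)"
    proof (cases r)
      case 0
      then show ?thesis by simp
    next
      case (Suc u)
      have ltu: "enat u < supp_card \<nu>"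
        using lt Suc by (metis enat_ord_simps(2) lessI less_trans)
      have hu: "mnorm r > 0" using mnorm_pos[OF ltu] Suc by simp
      have orthu: "\<And>q. poly_below u q \<Longrightarrow> mean (mop (Suc u) * q) = 0"
        using less(1)[of u] \<open>k = Suc r\<close> Suc less_imp_le[OF ltu] by simp
      have "mean (mop r * t) = coeff t u * mnorm r"
        using mop_orth_step[OF orthu, of t] t Suc by simp
      moreover have "mean (mop r * mop (Suc r)) = 0"
        using orth[OF mop_below] by (simp add: mult.commute)
      ultimately show ?thesis
        using Suc hu by (simp add: qt algebra_simps)
    qed
    have "mop (Suc k) * q
        = mop (Suc r) * pCons 0 q - smult (mdiag r) (mop (Suc r) * q)
            - smult (mnorm (Suc r) / mnorm r) (mop r * q)"
    proof -
      have "mop (Suc k)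
          = pCons 0 (mop (Suc r)) - smult (mdiag r) (mop (Suc r))
              - smult (mnorm (Suc r) / mnorm r) (mop r)"
        using mop_rec[of r] Suc by simp
      then show ?thesis
        by (simp add: left_diff_distrib)
    qed
    then have "mean (mop (Suc k) * q)
        = mean (mop (Suc r) * pCons 0 q) - mdiag r * (c * mnorm (Suc r))
            - coeff (pCons 0 t) r * mnorm (Suc r)"
      using 2 3 by simp
    also have "mop (Suc r) * pCons 0 q
        = mop (Suc r) * pCons 0 t + smult c (pCons 0 (mop (Suc r)) * mop (Suc r))"
      by (subst qt) (simp add: distrib_left mult.commute)
    also have "mean \<dots> = coeff (pCons 0 t) r * mnorm (Suc r) + c * (mdiag r * mnorm (Suc r))"
      using 1 h unfolding mean_add mean_smult by (simp add: mdiag_def mnorm_def[symmetric])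
    finally show ?thesis by simp
  qed
qed

lemma mop_orth': "enat k \<le> supp_card \<nu> \<Longrightarrow> poly_below (Suc k) q
    \<Longrightarrow> mean (mop (Suc k) * q) = coeff q k * mnorm (Suc k)"
  by (intro mop_orth_step mop_orth)

text \<open>For a support of \<open>m\<close> points, \<open>\<pi>\<^sub>m\<close> is orthogonal to all lower degrees, so
  its squared norm is its product with any monic polynomial of degree \<open>m\<close>; choose the one
  that vanishes on the support. This zero is how the program recognises a finite support.\<close>

lemma mnorm_eq_0:
  assumes "supp_card \<nu> = enat m"
  shows "mnorm (Suc m) = 0" "x \<in> supp \<nu> \<Longrightarrow> poly (mop (Suc m)) x = 0"
proof -
  have fin: "finite (supp \<nu>)" "card (supp \<nu>) = m"
    using assms by (auto simp: supp_card_def split: if_splits)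
  define w where "w = (\<Prod>x\<in>supp \<nu>. [:-x, 1:])"
  have dw: "degree w = m"
    unfolding w_def using fin by (subst degree_prod_eq_sum_degree) auto
  have lw: "coeff w m = 1"
    using lead_coeff_prod[of "\<lambda>x::real. [:-x, 1:]" "supp \<nu>"] dw by (simp add: w_def)
  have "poly_below (Suc m) w"
    using dw by (auto simp: poly_below_def coeff_eq_0)
  from mop_orth'[OF _ this] have "mean (mop (Suc m) * w) = mnorm (Suc m)"
    using lw assms by simp
  moreover have "mean (mop (Suc m) * w) = mean 0"
    using fin by (intro mean_cong_supp) (auto simp: w_def poly_prod)
  ultimately show *: "mnorm (Suc m) = 0" by simp
  show "poly (mop (Suc m)) x = 0" if "x \<in> supp \<nu>"
    using mean_square_eq_0D[OF _ that] * by (simp add: mnorm_def)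
qed

section \<open>The Jacobi coefficients\<close>

definition onp :: "nat \<Rightarrow> real poly" where
  "onp n = smult (1 / sqrt (mnorm (Suc n))) (mop (Suc n))"

text \<open>Uniqueness: the difference between a competitor and the multiple of \<open>\<pi>\<^sub>n\<close> with the
  same leading coefficient is of lower degree and orthogonal to itself, hence zero by
  definiteness.\<close>

lemma orthonormal_poly_eq:
  assumes n: "enat n < supp_card \<nu>"
  shows "orthonormal_poly \<nu> n = onp n"
  unfolding orthonormal_poly_def
proof (rule the_equality)
  have h: "mnorm (Suc n) > 0" by (rule mnorm_pos[OF n])
  have i1: "(LINT s|\<nu>. poly p s * poly q s) = mean (p * q)" for p q
    by (simp add: mean_def)
  have i2: "(LINT s|\<nu>. (poly p s)\<^sup>2) = mean (p * p)" for p
    by (simp add: mean_def power2_eq_square)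
  have orth: "mean (mop (Suc n) * q) = 0" if "degree q < n" for q
    using that n by (intro mop_orth) (auto simp: poly_below_iff_degree)
  show "degree (onp n) = n \<and> lead_coeff (onp n) > 0 \<and>
        (\<forall>q. degree q < n \<longrightarrow> (LINT s|\<nu>. poly (onp n) s * poly q s) = 0) \<and>
        (LINT s|\<nu>. (poly (onp n) s)\<^sup>2) = 1"
    using h orth unfolding i1 i2 by (auto simp: onp_def mnorm_def[symmetric])
  fix p assume "degree p = n \<and> lead_coeff p > 0 \<and>
        (\<forall>q. degree q < n \<longrightarrow> (LINT s|\<nu>. poly p s * poly q s) = 0) \<and>
        (LINT s|\<nu>. (poly p s)\<^sup>2) = 1"
  then have p: "degree p = n" "lead_coeff p > 0"
      "\<And>q. degree q < n \<Longrightarrow> mean (p * q) = 0" "mean (p * p) = 1"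
    unfolding i1 i2 by auto
  define c where "c = lead_coeff p"
  define r where "r = p - smult c (mop (Suc n))"
  have r: "poly_below n r"
    unfolding r_def c_def p(1)
    by (intro poly_below_reduce) (auto simp: poly_below_iff_degree p(1))
  have "r = 0"
  proof (rule ccontr)
    assume "r \<noteq> 0"
    then have n0: "0 < n" using r by (cases n) auto
    then have dr: "degree r < n" using r by (simp add: poly_below_iff_degree)
    have "mean (r * r) = mean (p * r) - c * mean (mop (Suc n) * r)"
      by (subst r_def) (simp add: algebra_simps)
    also have "\<dots> = 0"
      using p(3)[OF dr] orth[OF dr] by simp
    finally show False
      using mean_square_pos[of r] \<open>r \<noteq> 0\<close> dr n by (metis enat_ord_simps(2) less_irrefl less_trans)
  qed
  then have pe: "p = smult c (mop (Suc n))" by (simp add: r_def)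
  then have "c\<^sup>2 * mnorm (Suc n) = 1"
    using p(4) by (simp add: mnorm_def power2_eq_square)
  then have "c\<^sup>2 = (1 / sqrt (mnorm (Suc n)))\<^sup>2"
    using h by (simp add: power_divide field_simps)
  then have "c = 1 / sqrt (mnorm (Suc n))"
    using p(2) h by (subst (asm) power2_eq_iff_nonneg) (auto simp: c_def)
  then show "p = onp n"
    using pe by (simp add: onp_def)
qed

lemma mean_onp:
  assumes "enat i < supp_card \<nu>" "enat j < supp_card \<nu>"
  shows "mean (onp i * onp j) = (if i = j then 1 else 0)"
proof -
  have *: "mean (onp i * onp j) = 0" if "enat i < supp_card \<nu>" "j < i" for i j
  proof -
    have "mean (mop (Suc i) * mop (Suc j)) = 0"
      using that by (intro mop_orth) (auto simp: poly_below_def coeff_eq_0)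
    then show ?thesis by (simp add: onp_def)
  qed
  have "mean (onp i * onp i) = 1"
    using mnorm_pos[OF assms(1)] by (simp add: onp_def mnorm_def[symmetric])
  then show ?thesis
    using *[OF assms(1), of j] *[OF assms(2), of i]
        by (cases i j rule: linorder_cases) (auto simp: mult.commute)
qed

definition diag_coeff :: "nat \<Rightarrow> real" where
  "diag_coeff n = (if enat n < supp_card \<nu> then mdiag n else 0)"

text \<open>At index 0 this gives the required value 0, the denominator being zero.\<close>

definition off_coeff :: "nat \<Rightarrow> real" where
  "off_coeff n = (if enat n < supp_card \<nu> then sqrt (mnorm (Suc n) / mnorm n) else 0)"

text \<open>The monic recurrence divided by the norm of \<open>\<pi>\<^sub>n\<close>. At the last index
  \<open>n = supp_card \<nu> - 1\<close> the polynomial \<open>\<pi>\<close> of the next index vanishes on the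
  support, which matches the vanishing of the coefficient of the next index.\<close>

lemma onp_rec:
  assumes n: "enat n < supp_card \<nu>" and s: "s \<in> supp \<nu>"
  shows "s * poly (onp n) s
      = off_coeff (Suc n) * poly (onp (Suc n)) s + diag_coeff n * poly (onp n) s
          + off_coeff n * poly (onp (n - 1)) s"
proof -
  have h: "mnorm (Suc n) > 0" by (rule mnorm_pos[OF n])
  have "s * poly (onp n) s = poly (pCons 0 (mop (Suc n))) s / sqrt (mnorm (Suc n))"
    by (simp add: onp_def)
  also have "\<dots> = poly (mop (Suc (Suc n))) s / sqrt (mnorm (Suc n)) + mdiag n * poly (onp n) s
      + mnorm (Suc n) / mnorm n * poly (mop n) s / sqrt (mnorm (Suc n))"
    by (simp only: mop_rec) (simp add: onp_def add_divide_distrib)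
  also have "poly (mop (Suc (Suc n))) s / sqrt (mnorm (Suc n))
      = off_coeff (Suc n) * poly (onp (Suc n)) s"
  proof (cases "enat (Suc n) < supp_card \<nu>")
    case True
    then have "mnorm (Suc (Suc n)) > 0" using mnorm_pos by simp
    with h True show ?thesis
      by (simp add: onp_def off_coeff_def real_sqrt_divide)
  next
    case False
    then have "supp_card \<nu> = enat (Suc n)"
      using n by (cases "supp_card \<nu>") auto
    with False show ?thesis
      using mnorm_eq_0(2)[OF _ s] by (simp add: off_coeff_def)
  qed
  also have "mnorm (Suc n) / mnorm n * poly (mop n) s / sqrt (mnorm (Suc n))
      = off_coeff n * poly (onp (n - 1)) s"
  proof (cases n)
    case 0
    then show ?thesis by (simp add: off_coeff_def)
  next
    case (Suc r)
    have r: "enat r < supp_card \<nu>"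
      using n Suc by (metis enat_ord_simps(2) lessI less_trans)
    have hn: "mnorm n > 0" using mnorm_pos[OF r] Suc by simp
    have "mnorm (Suc n) = sqrt (mnorm (Suc n)) * sqrt (mnorm (Suc n))"
        "mnorm n = sqrt (mnorm n) * sqrt (mnorm n)"
      using h hn by auto
    then have "mnorm (Suc n) / mnorm n / sqrt (mnorm (Suc n))
        = sqrt (mnorm (Suc n)) / sqrt (mnorm n) / sqrt (mnorm n)"
      using h hn by (simp add: divide_simps)
    then show ?thesis
      using n Suc h hn
      by (simp add: onp_def off_coeff_def real_sqrt_divide) (simp add: field_simps)
  qed
  finally show ?thesis
    using n by (simp add: diag_coeff_def)
qed

lemma is_recurrence_coeffs_coeff: "is_recurrence_coeffs \<nu> diag_coeff off_coeff"
  unfolding is_recurrence_coeffs_def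
proof (intro conjI allI impI ballI)
  fix n s assume n: "enat n < supp_card \<nu>" and s: "s \<in> supp \<nu>"
  have n1: "enat (n - 1) < supp_card \<nu>"
    using n by (metis diff_le_self enat_ord_simps(1) order_le_less_trans)
  have "off_coeff (n + 1) * poly (orthonormal_poly \<nu> (n + 1)) s
      = off_coeff (Suc n) * poly (onp (Suc n)) s"
    using orthonormal_poly_eq[of "Suc n"]
        by (cases "enat (Suc n) < supp_card \<nu>") (auto simp: off_coeff_def)
  then show "s * poly (orthonormal_poly \<nu> n) s =
          off_coeff (n + 1) * poly (orthonormal_poly \<nu> (n + 1)) s
          + diag_coeff n * poly (orthonormal_poly \<nu> n) s
          + off_coeff n * poly (orthonormal_poly \<nu> (n - 1)) s"
    using onp_rec[OF n s] orthonormal_poly_eq[OF n] orthonormal_poly_eq[OF n1] by auto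
qed (auto simp: diag_coeff_def off_coeff_def)

text \<open>The formulas express \<open>a\<close> and \<open>b\<close> through the orthonormal polynomials
  alone; they result from multiplying the recurrence by one of these polynomials and integrating
  it.\<close>

lemma recurrence_coeffs_unique:
  assumes "is_recurrence_coeffs \<nu> a b"
  shows "a n = (if enat n < supp_card \<nu> then mean (pCons 0 (onp n) * onp n) else 0)" (is ?A)
    and "b n = (if n > 0 \<and> enat n < supp_card \<nu> then mean (pCons 0 (onp (n - 1)) * onp n) else 0)"
        (is ?B)
proof -
  have rec: "mean (pCons 0 (onp i) * onp j) = b (Suc i) * (if Suc i = j then 1 else 0)
        + a i * (if i = j then 1 else 0) + b i * (if i = Suc j then 1 else 0)"
    if i: "enat i < supp_card \<nu>" and j: "enat j < supp_card \<nu>" for i j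
  proof -
    have i': "enat (i - 1) < supp_card \<nu>"
      using i by (metis diff_le_self enat_ord_simps(1) order_le_less_trans)
    have "mean (pCons 0 (onp i) * onp j)
        = mean (smult (b (Suc i)) (onp (Suc i) * onp j) + smult (a i) (onp i * onp j)
            + smult (b i) (onp (i - 1) * onp j))"
    proof (rule mean_cong_supp)
      fix x assume x: "x \<in> supp \<nu>"
      have "x * poly (onp i) x = b (i + 1) * poly (orthonormal_poly \<nu> (i + 1)) x
          + a i * poly (onp i) x + b i * poly (onp (i - 1)) x"
        using assms i x orthonormal_poly_eq[OF i] orthonormal_poly_eq[OF i']
        unfolding is_recurrence_coeffs_def by metis
      moreover have "b (i + 1) * poly (orthonormal_poly \<nu> (i + 1)) x
          = b (Suc i) * poly (onp (Suc i)) x"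
      proof (cases "enat (Suc i) < supp_card \<nu>")
        case True
        then show ?thesis using orthonormal_poly_eq[OF True] by simp
      next
        case False
        then have "b (Suc i) = 0"
          using assms unfolding is_recurrence_coeffs_def by (metis linorder_not_less)
        then show ?thesis by simp
      qed
      ultimately show "poly (pCons 0 (onp i) * onp j) x =
          poly (smult (b (Suc i)) (onp (Suc i) * onp j) + smult (a i) (onp i * onp j)
              + smult (b i) (onp (i - 1) * onp j)) x"
        by (simp add: mult.assoc[symmetric] distrib_right)
    qed
    also have "\<dots>
        = b (Suc i) * mean (onp (Suc i) * onp j) + a i * mean (onp i * onp j)
            + b i * mean (onp (i - 1) * onp j)"
      by simp
    also have "b (Suc i) * mean (onp (Suc i) * onp j) = b (Suc i) * (if Suc i = j then 1 else 0)"
    proof (cases "enat (Suc i) < supp_card \<nu>")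
      case True
      then show ?thesis using mean_onp[OF True j] by simp
    next
      case False
      then have "b (Suc i) = 0"
        using assms unfolding is_recurrence_coeffs_def by (metis linorder_not_less)
      then show ?thesis by simp
    qed
    also have "b i * mean (onp (i - 1) * onp j) = b i * (if i = Suc j then 1 else 0)"
    proof (cases i)
      case 0
      then have "b i = 0" using assms unfolding is_recurrence_coeffs_def by simp
      then show ?thesis by simp
    next
      case (Suc u)
      then show ?thesis using mean_onp[OF i' j] by simp
    qed
    finally show ?thesis using mean_onp[OF i j] by simp
  qed
  show ?A
    using rec[of n n] assms unfolding is_recurrence_coeffs_def by (auto simp: not_less)
  show ?B
  proof (cases "n > 0 \<and> enat n < supp_card \<nu>")
    case True
    then have "enat (n - 1) < supp_card \<nu>"
      by (metis diff_le_self enat_ord_simps(1) order_le_less_trans)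
    then show ?thesis using rec[of "n - 1" n] True by auto
  next
    case False
    then show ?thesis using assms unfolding is_recurrence_coeffs_def by (auto simp: not_less)
  qed
qed

lemma recurrence_coeffs_eq: "recurrence_coeffs \<nu> = (diag_coeff, off_coeff)"
  unfolding recurrence_coeffs_def
proof (rule the_equality)
  show "is_recurrence_coeffs \<nu> (fst (diag_coeff, off_coeff)) (snd (diag_coeff, off_coeff))"
    using is_recurrence_coeffs_coeff by simp
  fix ab assume "is_recurrence_coeffs \<nu> (fst ab) (snd ab)"
  then show "ab = (diag_coeff, off_coeff)"
    using recurrence_coeffs_unique[OF is_recurrence_coeffs_coeff] recurrence_coeffs_unique[of
        "fst ab" "snd ab"]
    by (intro prod_eqI ext) auto
qed

lemma jacobi_a_eq: "jacobi_a \<nu> = diag_coeff" and jacobi_b_eq: "jacobi_b \<nu> = off_coeff"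
  by (simp_all add: jacobi_a_def jacobi_b_def recurrence_coeffs_eq)

section \<open>From moments to Jacobi coefficients\<close>

definition moment :: "nat \<Rightarrow> real" where
  "moment l = mean (monom 1 l)"

text \<open>The table of the Chebyshev algorithm: row \<open>Suc k\<close> contains the integrals of
  \<open>\<pi>\<^sub>k\<close> against the monomials. The row with index 1 is the moment sequence, each further row
  follows from the two preceding ones, and both the norms and the diagonal coefficients can be
  read off the entries next to the diagonal.\<close>

definition op_moment :: "nat \<Rightarrow> nat \<Rightarrow> real" where
  "op_moment r l = mean (mop r * monom 1 l)"

lemma moment_eq: "moment l = (LINT s|\<nu>. s ^ l)"
  by (simp add: moment_def mean_def poly_monom)

lemma moment_0 [simp]: "moment 0 = 1"
  by (simp add: moment_eq prob_space)

lemma op_moment_0: "op_moment 0 l = 0" and op_moment_1: "op_moment (Suc 0) l = moment l"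
  by (simp_all add: op_moment_def moment_def)

lemma poly_below_monom: "l < k \<Longrightarrow> poly_below k (monom 1 l)"
  by (auto simp: poly_below_def)

lemma op_moment_diag:
  assumes "enat k \<le> supp_card \<nu>"
  shows "op_moment (Suc k) k = mnorm (Suc k)"
  using mop_orth'[OF assms poly_below_monom[of k]] by (simp add: op_moment_def)

text \<open>Since \<open>0 - 1 = 0\<close> on the natural numbers and row 0 vanishes, the diagonal entry in
  this form is available for \<open>r = 0\<close> as well.\<close>

lemma op_moment_diag': "enat r \<le> supp_card \<nu> \<Longrightarrow> op_moment r (r - 1) = mnorm r"
proof (cases r)
  case (Suc k)
  assume "enat r \<le> supp_card \<nu>"
  then have "enat k \<le> supp_card \<nu>"
    using Suc by (metis Suc_ile_eq less_imp_le)
  then show ?thesis using op_moment_diag Suc by simp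
qed (simp add: op_moment_0)

lemma op_moment_rec_aux:
  "op_moment (Suc r) (Suc l)
      = op_moment (Suc (Suc r)) l + mdiag r * op_moment (Suc r) l
          + mnorm (Suc r) / mnorm r * op_moment r l"
proof -
  have "mop (Suc r) * monom 1 (Suc l) = pCons 0 (mop (Suc r)) * monom 1 l"
    by (simp add: monom_Suc)
  then show ?thesis
    unfolding op_moment_def by (simp only: mop_rec) (simp add: algebra_simps)
qed

text \<open>Integrate the recurrence for \<open>\<pi>\<^sub>r\<close> against the monomial of degree \<open>r\<close> and
  divide by the squared norm of \<open>\<pi>\<^sub>r\<close>: the term of index \<open>r + 1\<close> drops out by
  orthogonality.\<close>

lemma mdiag_eq:
  assumes r: "enat r < supp_card \<nu>"
  shows "mdiag r
      = op_moment (Suc r) (Suc r) / op_moment (Suc r) r - op_moment r r / op_moment r (r - 1)"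
proof -
  have h: "mnorm (Suc r) > 0" by (rule mnorm_pos[OF r])
  have "op_moment (Suc (Suc r)) r = 0"
    unfolding op_moment_def using r by (intro mop_orth poly_below_monom) (simp_all add: Suc_ile_eq)
  then have "op_moment (Suc r) (Suc r)
      = mdiag r * mnorm (Suc r) + mnorm (Suc r) / mnorm r * op_moment r r"
    using op_moment_rec_aux[of r r] op_moment_diag[OF less_imp_le[OF r]] by simp
  then show ?thesis
    using h op_moment_diag[OF less_imp_le[OF r]] op_moment_diag'[OF less_imp_le[OF r]]
        by (simp add: field_simps)
qed

lemma op_moment_rec:
  assumes r: "enat r < supp_card \<nu>"
  shows "op_moment (Suc (Suc r)) l = op_moment (Suc r) (Suc l)
           - (op_moment (Suc r) (Suc r) / op_moment (Suc r) r - op_moment r r / op_moment r (r - 1))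
             * op_moment (Suc r) l
           - op_moment (Suc r) r / op_moment r (r - 1) * op_moment r l"
  using op_moment_rec_aux[of r l] op_moment_diag[OF less_imp_le[OF r]] op_moment_diag'[OF less_imp_le[OF r]]
  unfolding mdiag_eq[OF r] by simp

end

section \<open>From Jacobi coefficients to moments\<close>

text \<open>Entry \<open>i\<close> of the vector \<open>J\<^sup>l e\<^sub>0\<close>, for a tridiagonal matrix
  \<open>J\<close>.\<close>

fun krylov :: "(nat \<Rightarrow> nat \<Rightarrow> real) \<Rightarrow> nat \<Rightarrow> nat \<Rightarrow> real" where
  "krylov J 0 i = (if i = 0 then 1 else 0)"
| "krylov J (Suc l) i =
     (if i = 0 then 0 else J i (i - 1) * krylov J l (i - 1)) + J i i * krylov J l i
     + J i (Suc i) * krylov J l (Suc i)"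

lemma krylov_eq_0: "l < i \<Longrightarrow> krylov J l i = 0"
  by (induction l arbitrary: i) auto

text \<open>An entry of index \<open>n\<close> or above can influence entry \<open>i\<close> only after the
  vector has spread from index 0 to index \<open>n\<close> and back to \<open>i\<close>, which takes at
  least \<open>2 * n - i\<close> multiplications. Hence the truncation of size \<open>n\<close> determines
  the moments of order below \<open>2 * n\<close>, which are exactly those that enter into the
  coefficients \<open>a\<^sub>0, b\<^sub>1, \<dots>, a\<close> up to index \<open>n - 1\<close>.\<close>

lemma krylov_truncate:
  assumes "l + i < 2 * n"
  shows "krylov (mentry (truncate_matrix n A)) l i = (if i < n then krylov (mentry A) l i else 0)"
  using assms
proof (induction l arbitrary: i)
  case 0
  then show ?case by auto
next
  case (Suc l)
  show ?case
  proof (cases "i < n")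
    case False
    then show ?thesis by (simp add: truncate_matrix_def)
  next
    case True
    let ?T = "truncate_matrix n A"
    have "krylov (mentry A) l (Suc i) = 0" if "\<not> Suc i < n"
      using that True Suc.prems by (intro krylov_eq_0) auto
    then have "mentry ?T i (Suc i) * krylov (mentry ?T) l (Suc i)
        = mentry A i (Suc i) * krylov (mentry A) l (Suc i)"
      using Suc True by (cases "Suc i < n") (simp_all add: truncate_matrix_def)
    moreover have "mentry ?T i i * krylov (mentry ?T) l i = mentry A i i * krylov (mentry A) l i"
      using Suc True by (simp add: truncate_matrix_def)
    moreover have "mentry ?T i (i - 1) * krylov (mentry ?T) l (i - 1)
        = mentry A i (i - 1) * krylov (mentry A) l (i - 1)"
      using Suc True by (simp add: truncate_matrix_def)
    ultimately show ?thesis using True by simp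
  qed
qed

context unit_measure
begin

text \<open>The matrix represents multiplication by \<open>s\<close> in the orthonormal basis, so
  \<open>J\<^sup>l e\<^sub>0\<close> lists the coordinates of \<open>s\<^sup>l\<close>. For a finite support this is true of the
  space of functions on the support.\<close>

lemma krylov_jacobi:
  "krylov (mentry (jacobi_matrix \<nu>)) l k
      = (if enat k < supp_card \<nu> then mean (monom 1 l * onp k) else 0)"
proof (induction l arbitrary: k)
  case 0
  have "onp 0 = 1" by (simp add: onp_def)
  then show ?case
    using mean_onp[of k 0] supp_card_pos by (auto simp: zero_enat_def)
next
  case (Suc l)
  show ?case
  proof (cases "enat k < supp_card \<nu>")
    case False
    then show ?thesis by (simp add: jacobi_matrix_def)
  next
    case True
    have "enat (k - 1) < supp_card \<nu>"
      using True by (metis diff_le_self enat_ord_simps(1) order_le_less_trans)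
    then have a: "(if k = 0 then 0
        else mentry (jacobi_matrix \<nu>) k (k - 1) * krylov (mentry (jacobi_matrix \<nu>)) l (k - 1))
        = off_coeff k * mean (monom 1 l * onp (k - 1))"
      using True Suc by (auto simp: jacobi_matrix_def jacobi_b_eq off_coeff_def)
    have b: "mentry (jacobi_matrix \<nu>) k (Suc k) * krylov (mentry (jacobi_matrix \<nu>)) l (Suc k)
        = off_coeff (Suc k) * mean (monom 1 l * onp (Suc k))"
      using True Suc by (auto simp: jacobi_matrix_def jacobi_b_eq off_coeff_def)
    have c: "mentry (jacobi_matrix \<nu>) k k = diag_coeff k"
      using True by (auto simp: jacobi_matrix_def jacobi_a_eq)
    have "mean (monom 1 (Suc l) * onp k) = mean (smult (off_coeff (Suc k)) (monom 1 l * onp (Suc k))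
            + smult (diag_coeff k) (monom 1 l * onp k)
            + smult (off_coeff k) (monom 1 l * onp (k - 1)))"
    proof (rule mean_cong_supp)
      fix x assume "x \<in> supp \<nu>"
      from onp_rec[OF True this]
      have "x ^ l * (x * poly (onp k) x)
          = x ^ l * (off_coeff (Suc k) * poly (onp (Suc k)) x + diag_coeff k * poly (onp k) x
              + off_coeff k * poly (onp (k - 1)) x)"
        by simp
      then show "poly (monom 1 (Suc l) * onp k) x
          = poly (smult (off_coeff (Suc k)) (monom 1 l * onp (Suc k))
            + smult (diag_coeff k) (monom 1 l * onp k)
            + smult (off_coeff k) (monom 1 l * onp (k - 1))) x"
        by (simp add: poly_monom algebra_simps)
    qed
    then show ?thesis
      using True Suc unfolding krylov.simps a b c by simp
  qed
qed

lemma moment_krylov: "krylov (mentry (jacobi_matrix \<nu>)) l 0 = moment l"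
  using supp_card_pos by (auto simp: krylov_jacobi moment_def onp_def zero_enat_def)

end

section \<open>The invariant measure\<close>

locale affine_ifs =
  fixes \<delta> :: real and \<sigma> \<mu> :: "real measure"
  assumes delta: "0 \<le> \<delta>" "\<delta> < 1"
    and sigma: "\<sigma> \<in> prob_measures_on {-1..1}"
    and invariant: "ifs_invariant \<delta> \<sigma> \<mu>"
begin

sublocale sigma: unit_measure \<sigma>
  using sigma by (auto simp: prob_measures_on_def unit_measure_def unit_measure_axioms_def)

lemma prob_mu: "prob_space \<mu>" and sets_mu: "sets \<mu> = sets borel"
  using invariant by (auto simp: ifs_invariant_def)

lemma invariance:
  fixes f :: "real \<Rightarrow> real"
  assumes "continuous_on UNIV f"
  shows "(LINT s|\<mu>. f s) = (LINT \<beta>|\<sigma>. (LINT s|\<mu>. f (ifs_map \<delta> \<beta> s)))"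
  using invariant assms by (auto simp: ifs_invariant_def)

text \<open>Polynomials may be inserted into the invariance equation profitably only once
  \<open>\<mu>\<close> is known to have bounded support. The bounded functions \<open>cutoff c\<close> are
  positive exactly outside the unit interval (for \<open>c > 0\<close>), and the maps of the system
  contract the distance to this interval at least by the factor \<open>\<delta>\<close>. Applying one
  of them therefore has at most the effect of replacing \<open>c\<close> by \<open>\<delta> * c\<close>.\<close>

definition cutoff :: "real \<Rightarrow> real \<Rightarrow> real" where
  "cutoff c s = min 1 (max 0 (c * (\<bar>s\<bar> - 1)))"

lemma continuous_cutoff: "continuous_on A (cutoff c)"
  unfolding cutoff_def by (intro continuous_intros)

lemma measurable_cutoff: "cutoff c \<in> borel_measurable \<mu>"
  using borel_measurable_continuous_onI[OF continuous_cutoff[of UNIV c]] sets_mu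
  by (simp cong: measurable_cong_sets)

lemma cutoff_range: "0 \<le> cutoff c s" "cutoff c s \<le> 1"
  by (auto simp: cutoff_def)

lemma integrable_cutoff_comp:
  assumes "continuous_on UNIV g"
  shows "integrable \<mu> (\<lambda>s. cutoff c (g s))"
proof -
  interpret mu: prob_space \<mu> by (rule prob_mu)
  have "(\<lambda>s. cutoff c (g s)) \<in> borel_measurable \<mu>"
    using borel_measurable_continuous_onI[OF continuous_on_compose2[OF continuous_cutoff[of UNIV c] assms]] sets_mu
    by (simp cong: measurable_cong_sets)
  then show ?thesis
    using cutoff_range by (intro mu.integrable_const_bound[where B = 1]) auto
qed

lemma cutoff_ifs:
  assumes "\<bar>\<beta>\<bar> \<le> 1" "0 \<le> c"
  shows "cutoff c (ifs_map \<delta> \<beta> s) \<le> cutoff (\<delta> * c) s"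
proof -
  have "\<bar>ifs_map \<delta> \<beta> s\<bar> \<le> \<delta> * \<bar>s\<bar> + (1 - \<delta>) * \<bar>\<beta>\<bar>"
    unfolding ifs_map_def using delta by (simp add: abs_mult order_trans[OF abs_triangle_ineq])
  also have "(1 - \<delta>) * \<bar>\<beta>\<bar> \<le> (1 - \<delta>) * 1"
    using delta assms by (intro mult_left_mono) auto
  finally have "c * (\<bar>ifs_map \<delta> \<beta> s\<bar> - 1) \<le> c * (\<delta> * (\<bar>s\<bar> - 1))"
    using assms(2) by (intro mult_left_mono) (auto simp: algebra_simps)
  then show ?thesis
    by (auto simp: cutoff_def mult_ac min_def max_def)
qed

lemma integral_cutoff_le:
  assumes "0 \<le> c"
  shows "(LINT s|\<mu>. cutoff c s) \<le> (LINT s|\<mu>. cutoff (\<delta> * c) s)"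
proof -
  have le: "(LINT s|\<mu>. cutoff c (ifs_map \<delta> \<beta> s)) \<le> (LINT s|\<mu>. cutoff (\<delta> * c) s)" if "\<bar>\<beta>\<bar> \<le> 1" for \<beta>
  proof (rule integral_mono)
    show "integrable \<mu> (\<lambda>s. cutoff c (ifs_map \<delta> \<beta> s))"
      unfolding ifs_map_def by (intro integrable_cutoff_comp continuous_intros)
    show "integrable \<mu> (cutoff (\<delta> * c))"
      using integrable_cutoff_comp[of "\<lambda>s. s"] by simp
  qed (use cutoff_ifs that assms in auto)
  have "(LINT s|\<mu>. cutoff c s) = (LINT \<beta>|\<sigma>. (LINT s|\<mu>. cutoff c (ifs_map \<delta> \<beta> s)))"
    by (intro invariance continuous_cutoff)
  also have "\<dots> \<le> (LINT s|\<mu>. cutoff (\<delta> * c) s)"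
  proof (cases "integrable \<sigma> (\<lambda>\<beta>. LINT s|\<mu>. cutoff c (ifs_map \<delta> \<beta> s))")
    case True
    then show ?thesis
      using sigma.AE_abs_le by (intro sigma.integral_le_const)
          (auto elim!: eventually_mono intro: le)
  next
    case False
    then show ?thesis
      using cutoff_range by (simp add: not_integrable_integral_eq)
  qed
  finally show ?thesis .
qed

text \<open>Iterating the contraction bounds the integral for \<open>c = 1\<close> by the one for
  \<open>c = \<delta> ^ n\<close>, which tends to zero by dominated convergence.\<close>

lemma integral_cutoff_eq_0: "(LINT s|\<mu>. cutoff 1 s) = 0"
proof -
  interpret mu: prob_space \<mu> by (rule prob_mu)
  have le: "(LINT s|\<mu>. cutoff 1 s) \<le> (LINT s|\<mu>. cutoff (\<delta> ^ n) s)" for n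
  proof (induction n)
    case (Suc n)
    then show ?case
      using integral_cutoff_le[of "\<delta> ^ n"] delta by simp
  qed simp
  have "(\<lambda>n. LINT s|\<mu>. cutoff (\<delta> ^ n) s) \<longlonglongrightarrow> (LINT s|\<mu>. 0)"
  proof (rule integral_dominated_convergence[where w = "\<lambda>_. 1"])
    show "AE s in \<mu>. (\<lambda>n. cutoff (\<delta> ^ n) s) \<longlonglongrightarrow> 0"
    proof (rule AE_I2)
      fix s :: real
      have "(\<lambda>n. \<delta> ^ n) \<longlonglongrightarrow> 0"
        using delta by (intro LIMSEQ_realpow_zero)
      then have "(\<lambda>n. cutoff (\<delta> ^ n) s) \<longlonglongrightarrow> min 1 (max 0 (0 * (\<bar>s\<bar> - 1)))"
        unfolding cutoff_def by (intro tendsto_min tendsto_max tendsto_mult tendsto_const)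
      then show "(\<lambda>n. cutoff (\<delta> ^ n) s) \<longlonglongrightarrow> 0" by simp
    qed
  qed (use measurable_cutoff cutoff_range in auto)
  then have "(\<lambda>n. LINT s|\<mu>. cutoff (\<delta> ^ n) s) \<longlonglongrightarrow> 0" by simp
  from LIMSEQ_le_const[OF this] le have "(LINT s|\<mu>. cutoff 1 s) \<le> 0" by auto
  moreover have "(LINT s|\<mu>. cutoff 1 s) \<ge> 0"
    using cutoff_range by (intro integral_nonneg_AE) auto
  ultimately show ?thesis by simp
qed

lemma supp_mu: "supp \<mu> \<subseteq> {-1..1}"
proof
  fix x assume x: "x \<in> supp \<mu>"
  show "x \<in> {-1..1}"
  proof (rule ccontr)
    assume "x \<notin> {-1..1}"
    then have x1: "x \<in> - {-1..1}" by simp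
    have "AE s in \<mu>. cutoff 1 s = 0"
      using integral_cutoff_eq_0 integral_nonneg_eq_0_iff_AE[of \<mu> "cutoff 1"] cutoff_range
        integrable_cutoff_comp[of "\<lambda>s. s" 1] by simp
    then have "AE s in \<mu>. s \<notin> - {-1..1}"
      by eventually_elim (auto simp: cutoff_def split: if_splits)
    moreover have "- {-1..1::real} \<in> sets \<mu>"
      using sets_mu by auto
    ultimately have "emeasure \<mu> (- {-1..1}) = 0"
      using AE_iff_measurable[of "- {-1..1}" \<mu>
          "\<lambda>y. y \<notin> - {-1..1}"] sets.sets_into_space by fastforce
    moreover have "open (- {-1..1::real})" by auto
    ultimately show False
      using x x1 unfolding supp_def by fastforce
  qed
qed

sublocale mu: unit_measure \<mu>
  using prob_mu sets_mu supp_mu by (simp add: unit_measure_def unit_measure_axioms_def)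

text \<open>Expanding \<open>ifs_map \<delta> \<beta> s ^ l\<close> one factor at a time, instead of by
  the binomial theorem, yields the moments of \<open>\<mu>\<close> from products of moments by a
  recurrence without binomial coefficients.\<close>

definition mixed_moment :: "nat \<Rightarrow> nat \<Rightarrow> nat \<Rightarrow> real" where
  "mixed_moment l i j = (LINT \<beta>|\<sigma>. LINT s|\<mu>. \<beta> ^ i * s ^ j * ifs_map \<delta> \<beta> s ^ l)"

lemma inner_integrable: "integrable \<mu> (\<lambda>s. \<beta> ^ i * s ^ j * ifs_map \<delta> \<beta> s ^ l)"
  unfolding ifs_map_def by (intro mu.integrable_continuous continuous_intros)

lemma inner_0: "(LINT s|\<mu>. \<beta> ^ i * s ^ j * ifs_map \<delta> \<beta> s ^ 0) = \<beta> ^ i * mu.moment j"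
  by (simp add: mu.moment_eq)

lemma inner_Suc:
  "(LINT s|\<mu>. \<beta> ^ i * s ^ j * ifs_map \<delta> \<beta> s ^ Suc l) =
     \<delta> * (LINT s|\<mu>. \<beta> ^ i * s ^ Suc j * ifs_map \<delta> \<beta> s ^ l)
     + (1 - \<delta>) * (LINT s|\<mu>. \<beta> ^ Suc i * s ^ j * ifs_map \<delta> \<beta> s ^ l)"
proof -
  have "\<beta> ^ i * s ^ j * ifs_map \<delta> \<beta> s ^ Suc l =
      \<delta> * (\<beta> ^ i * s ^ Suc j * ifs_map \<delta> \<beta> s ^ l)
      + (1 - \<delta>) * (\<beta> ^ Suc i * s ^ j * ifs_map \<delta> \<beta> s ^ l)" for s
    by (simp add: ifs_map_def algebra_simps)
  then show ?thesis
    using inner_integrable by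
        (simp only: Bochner_Integration.integral_add integrable_mult_right integral_mult_right_zero)
qed

lemma outer_integrable: "integrable \<sigma> (\<lambda>\<beta>. LINT s|\<mu>. \<beta> ^ i * s ^ j * ifs_map \<delta> \<beta> s ^ l)"
proof (induction l arbitrary: i j)
  case 0
  show ?case
    unfolding inner_0 by (intro sigma.integrable_continuous continuous_intros)
next
  case (Suc l)
  show ?case
    unfolding inner_Suc by (intro Bochner_Integration.integrable_add integrable_mult_right Suc)
qed

lemma mixed_moment_0: "mixed_moment 0 i j = sigma.moment i * mu.moment j"
  unfolding mixed_moment_def inner_0 by (simp add: sigma.moment_eq)

lemma mixed_moment_Suc: "mixed_moment (Suc l) i j
    = \<delta> * mixed_moment l i (Suc j) + (1 - \<delta>) * mixed_moment l (Suc i) j"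
  unfolding mixed_moment_def inner_Suc using outer_integrable
  by (simp only: Bochner_Integration.integral_add integrable_mult_right integral_mult_right_zero)

lemma mixed_moment_diag: "mixed_moment l 0 0 = mu.moment l"
proof -
  have "mu.moment l = (LINT \<beta>|\<sigma>. LINT s|\<mu>. ifs_map \<delta> \<beta> s ^ l)"
    unfolding mu.moment_eq by (intro invariance continuous_intros)
  then show ?thesis by (simp add: mixed_moment_def)
qed

text \<open>The moment of order \<open>L\<close> of \<open>\<mu>\<close> is the top
  \<open>mixed_moment L 0 0\<close> of a triangle whose base contains this same moment once, at position
  0, from where it contributes to the top with the factor \<open>\<delta> ^ L\<close>. The present triangle
  has the value 1 as a placeholder for the unknown moment at this position of the base. It thus
  depends on the moments of \<open>\<mu>\<close> of lower order only.\<close>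

definition moment_triangle :: "nat \<Rightarrow> nat \<Rightarrow> nat \<Rightarrow> real" where
  "moment_triangle L l i =
     mixed_moment l i (L - l - i) - (if i = 0 then \<delta> ^ l * (mu.moment L - 1) else 0)"

lemma moment_triangle_0: "i \<le> L
    \<Longrightarrow> moment_triangle L 0 i = sigma.moment i * (if i = 0 then 1 else mu.moment (L - i))"
  by (simp add: moment_triangle_def mixed_moment_0)

lemma moment_triangle_Suc:
  assumes "Suc l + i \<le> L"
  shows "moment_triangle L (Suc l) i
      = \<delta> * moment_triangle L l i + (1 - \<delta>) * moment_triangle L l (Suc i)"
proof -
  have "L - l - i = Suc (L - Suc l - i)" "L - l - Suc i = L - Suc l - i"
    using assms by auto
  then show ?thesis
    by (simp add: moment_triangle_def mixed_moment_Suc algebra_simps)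
qed

text \<open>The linear equation for the unknown moment, solved. With the placeholder 1 the formula is
  also right for \<open>L = 0\<close>, where it reads \<open>1 + 0 / 0\<close>.\<close>

lemma moment_triangle_top: "mu.moment L = 1 + (moment_triangle L L 0 - 1) / (1 - \<delta> ^ L)"
proof (cases L)
  case 0
  then show ?thesis by (simp add: moment_triangle_def mixed_moment_diag)
next
  case (Suc L')
  have "\<delta> ^ L < 1"
    using delta Suc by (intro power_less_one_iff[THEN iffD2]) auto
  moreover have "moment_triangle L L 0 - 1 = (mu.moment L - 1) * (1 - \<delta> ^ L)"
    by (simp add: moment_triangle_def mixed_moment_diag algebra_simps)
  ultimately show ?thesis by simp
qed

end

section \<open>Total correctness rules for the machine\<close>

definition reaches :: "real \<Rightarrow> sq_matrix \<Rightarrow> com \<times> state \<Rightarrow> com \<times> state \<Rightarrow> bool" where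
  "reaches \<delta> A x y \<longleftrightarrow> (\<exists>t. (step \<delta> A ^^ t) x = y)"

lemma reaches_refl [simp]: "reaches \<delta> A x x"
  unfolding reaches_def by (rule exI[of _ 0]) simp

lemma reaches_trans: "reaches \<delta> A x y \<Longrightarrow> reaches \<delta> A y z \<Longrightarrow> reaches \<delta> A x z"
  unfolding reaches_def by (metis funpow_add comp_apply)

lemma reaches_step: "reaches \<delta> A (step \<delta> A x) z \<Longrightarrow> reaches \<delta> A x z"
  unfolding reaches_def by (metis funpow_Suc_right comp_apply)

lemma reaches_Seq:
  assumes "reaches \<delta> A (c, s) (Skip, s')"
  shows "reaches \<delta> A (Seq c d, s) (d, s')"
proof -
  obtain t where "(step \<delta> A ^^ t) (c, s) = (Skip, s')"
    using assms by (auto simp: reaches_def)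
  then show ?thesis
  proof (induction t arbitrary: c s)
    case 0
    show ?case by (rule reaches_step) (use 0 in simp)
  next
    case (Suc t)
    show ?case
    proof (cases "c = Skip")
      case True
      have "(step \<delta> A ^^ t) (Skip, s) = (Skip, s)" for t
        by (induction t) auto
      with Suc.prems True have "s' = s" by (metis prod.inject)
      then show ?thesis by (intro reaches_step[of _ _ "(Seq c d, s)"]) (simp add: True)
    next
      case False
      obtain c' s1 where st: "step \<delta> A (c, s) = (c', s1)" by fastforce
      then have "reaches \<delta> A (Seq c' d, s1) (d, s')"
        using Suc by (simp add: funpow_Suc_right del: funpow.simps)
      then show ?thesis
        using st False by (intro reaches_step[of _ _ "(Seq c d, s)"]) simp
    qed
  qed
qed

text \<open>Execution is deterministic, so the existence of a terminating execution that leads to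
  \<open>Q\<close> is the weakest precondition for total correctness.\<close>

definition wp :: "real \<Rightarrow> sq_matrix \<Rightarrow> com \<Rightarrow> (state \<Rightarrow> bool) \<Rightarrow> state \<Rightarrow> bool" where
  "wp \<delta> A c Q s \<longleftrightarrow> (\<exists>s'. reaches \<delta> A (c, s) (Skip, s') \<and> Q s')"

lemma wp_mono: "wp \<delta> A c Q s \<Longrightarrow> (\<And>s. Q s \<Longrightarrow> Q' s) \<Longrightarrow> wp \<delta> A c Q' s"
  unfolding wp_def by blast

lemma wp_Skip: "Q s \<Longrightarrow> wp \<delta> A Skip Q s"
  unfolding wp_def using reaches_refl by blast

lemma wp_step: "wp \<delta> A (fst (step \<delta> A (c, s))) Q (snd (step \<delta> A (c, s))) \<Longrightarrow> wp \<delta> A c Q s"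
  unfolding wp_def using reaches_step by fastforce

lemma wp_SetReg: "Q (s\<lparr>regs := (regs s)(r := nval e s)\<rparr>) \<Longrightarrow> wp \<delta> A (SetReg r e) Q s"
  by (rule wp_step) (simp add: wp_Skip)

lemma wp_SetCell:
  "Q (s\<lparr>cells := (\<lambda>i' j' k'.
        if i' = nval i s \<and> j' = nval j s \<and> k' = nval k s then rval \<delta> A e s
        else cells s i' j' k')\<rparr>) \<Longrightarrow> wp \<delta> A (SetCell i j k e) Q s"
  by (rule wp_step) (simp add: wp_Skip)

lemma wp_Emit: "Q (s\<lparr>outputs := outputs s @ [rval \<delta> A e s]\<rparr>) \<Longrightarrow> wp \<delta> A (Emit e) Q s"
  by (rule wp_step) (simp add: wp_Skip)

lemma wp_Seq: "wp \<delta> A c (wp \<delta> A d Q) s \<Longrightarrow> wp \<delta> A (Seq c d) Q s"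
  unfolding wp_def using reaches_Seq reaches_trans by blast

lemma wp_Cond: "(if bval \<delta> A b s then wp \<delta> A c Q s else wp \<delta> A d Q s) \<Longrightarrow> wp \<delta> A (Cond b c d) Q s"
  by (rule wp_step) simp

lemma wp_CondT: "bval \<delta> A b s \<Longrightarrow> wp \<delta> A c Q s \<Longrightarrow> wp \<delta> A (Cond b c d) Q s"
  and wp_CondF: "\<not> bval \<delta> A b s \<Longrightarrow> wp \<delta> A d Q s \<Longrightarrow> wp \<delta> A (Cond b c d) Q s"
  by (auto intro: wp_Cond)

lemma wp_While_end: "\<not> bval \<delta> A b s \<Longrightarrow> Q s \<Longrightarrow> wp \<delta> A (While b c) Q s"
  by (rule wp_step) (simp add: wp_Skip)

lemma wp_While_step:
  "bval \<delta> A b s \<Longrightarrow> wp \<delta> A c (wp \<delta> A (While b c) Q) s \<Longrightarrow> wp \<delta> A (While b c) Q s"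
  by (rule wp_step) (simp add: wp_Seq)

text \<open>The register \<open>r\<close> counts from 0 to the value of \<open>e\<close>, exclusively.\<close>

definition For :: "nat \<Rightarrow> nexp \<Rightarrow> com \<Rightarrow> com" where
  "For r e c = Seq (SetReg r (NConst 0))
     (While (NLess (NReg r) e) (Seq c (SetReg r (NAdd (NReg r) (NConst 1)))))"

lemma wp_For:
  assumes init: "I 0 (s\<lparr>regs := (regs s)(r := 0)\<rparr>)"
    and bound: "\<And>i s. I i s \<Longrightarrow> nval e s = n"
    and body: "\<And>i s. I i s \<Longrightarrow> regs s r = i \<Longrightarrow> i < n \<Longrightarrow>
      wp \<delta> A c (\<lambda>s'. regs s' r = i \<and> I (Suc i) (s'\<lparr>regs := (regs s')(r := Suc i)\<rparr>)) s"
    and final: "\<And>s. I n s \<Longrightarrow> Q s"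
  shows "wp \<delta> A (For r e c) Q s"
proof -
  have "wp \<delta> A (While (NLess (NReg r) e) (Seq c (SetReg r (NAdd (NReg r) (NConst 1))))) Q s"
    if "I i s" "regs s r = i" "i \<le> n" for i s
    using that
  proof (induction "n - i" arbitrary: i s)
    case 0
    then show ?case
      using bound final by (intro wp_While_end) auto
  next
    case (Suc d)
    then have "i < n" by simp
    show ?case
    proof (intro wp_While_step wp_Seq)
      show "bval \<delta> A (NLess (NReg r) e) s"
        using Suc \<open>i < n\<close> bound by simp
      show "wp \<delta> A c (wp \<delta> A (SetReg r (NAdd (NReg r) (NConst 1)))
        (wp \<delta> A (While (NLess (NReg r) e) (Seq c (SetReg r (NAdd (NReg r) (NConst 1))))) Q)) s"
      proof (rule wp_mono[OF body[OF Suc.prems(1,2) \<open>i < n\<close>]], intro wp_SetReg)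
        fix s' assume "regs s' r = i \<and> I (Suc i) (s'\<lparr>regs := (regs s')(r := Suc i)\<rparr>)"
        then show "wp \<delta> A (While (NLess (NReg r) e) (Seq c (SetReg r (NAdd (NReg r) (NConst 1))))) Q
          (s'\<lparr>regs := (regs s')(r := nval (NAdd (NReg r) (NConst 1)) s')\<rparr>)"
          using Suc \<open>i < n\<close> by (intro Suc(1)[of "Suc i"]) auto
      qed
    qed
  qed
  then show ?thesis
    unfolding For_def using init by (intro wp_Seq wp_SetReg) auto
qed

text \<open>The frame condition: registers outside \<open>R\<close> and tables outside \<open>T\<close> keep
  their contents, and nothing is output. A table consists of the cells with a common first
  address.\<close>

definition unchanged :: "nat set \<Rightarrow> nat set \<Rightarrow> state \<Rightarrow> state \<Rightarrow> bool" where
  "unchanged R T s s' \<longleftrightarrow> outputs s' = outputs s \<and> (\<forall>r. r \<notin> R \<longrightarrow> regs s' r = regs s r) \<and>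
     (\<forall>c. c \<notin> T \<longrightarrow> cells s' c = cells s c)"

text \<open>Fills a triangular table row by row, row \<open>l\<close> up to column \<open>N - l\<close>
  exclusively. The command \<open>w\<close> has to write the entry whose row and column are found in
  registers 2 and 3. Triangles are what the recurrences need: apart from the coefficients of the
  Chebyshev recurrence, which come from entries next to the diagonal, they compute an entry from
  earlier rows and look at most one column further than the entry itself.\<close>

definition fill :: "nexp \<Rightarrow> nexp \<Rightarrow> com \<Rightarrow> com" where
  "fill eR eN w = For 2 eR (For 3 (NSub eN (NReg 2)) w)"

definition put :: "nat \<Rightarrow> nat \<Rightarrow> nat \<Rightarrow> real \<Rightarrow> state \<Rightarrow> state" where
  "put c l i x s = s\<lparr>cells := (\<lambda>c' l' i'.
     if c' = c \<and> l' = l \<and> i' = i then x else cells s c' l' i')\<rparr>"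

lemma put_simps [simp]:
  "regs (put c l i x s) = regs s" "outputs (put c l i x s) = outputs s"
  "cells (put c l i x s) c' l' i' = (if c' = c \<and> l' = l \<and> i' = i then x else cells s c' l' i')"
  by (simp_all add: put_def)

lemma wp_put:
  assumes "Q (put t (nval i s) (nval j s) (rval \<delta> A e s) s)"
  shows "wp \<delta> A (SetCell (NConst t) i j e) Q s"
  using assms by (intro wp_SetCell) (simp add: put_def)

lemma wp_fill:
  assumes w: "\<And>s' l i. unchanged {2,3} {c} s s' \<Longrightarrow> regs s' 2 = l \<Longrightarrow> regs s' 3 = i \<Longrightarrow> l < R
      \<Longrightarrow> i < N - l \<Longrightarrow>
      (\<And>l' i'. l' < l \<Longrightarrow> i' < N - l' \<Longrightarrow> cells s' c l' i' = f l' i') \<Longrightarrow>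
      wp \<delta> A w (\<lambda>s''. s'' = put c l i (f l i) s') s'"
    and R: "\<And>s'. unchanged {2,3} {c} s s' \<Longrightarrow> nval eR s' = R"
    and N: "\<And>s'. unchanged {2,3} {c} s s' \<Longrightarrow> nval eN s' = N"
    and Q: "\<And>s'. unchanged {2,3} {c} s s' \<Longrightarrow> (\<And>l i. l < R \<Longrightarrow> i < N - l \<Longrightarrow> cells s' c l i = f l i)
        \<Longrightarrow> Q s'"
  shows "wp \<delta> A (fill eR eN w) Q s"
  unfolding fill_def
proof (rule wp_For)
  let ?I = "\<lambda>l s'. unchanged {2,3} {c} s s' \<and> (\<forall>l'<l. \<forall>i'<N - l'. cells s' c l' i' = f l' i')"
  show "?I 0 (s\<lparr>regs := (regs s)(2 := 0)\<rparr>)" by (simp add: unchanged_def)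
  show "nval eR s' = R" if "?I l s'" for l s' using that R by blast
  show "Q s'" if "?I R s'" for s' using that by (intro Q) auto
  fix l s1 assume I: "?I l s1" and l: "regs s1 2 = l" "l < R"
  let ?J = "\<lambda>i s'. ?I l s' \<and> regs s' 2 = l \<and> (\<forall>i'<i. cells s' c l i' = f l i')"
  show "wp \<delta> A (For 3 (NSub eN (NReg 2)) w)
     (\<lambda>s'. regs s' 2 = l \<and> ?I (Suc l) (s'\<lparr>regs := (regs s')(2 := Suc l)\<rparr>)) s1"
  proof (rule wp_For)
    show "?J 0 (s1\<lparr>regs := (regs s1)(3 := 0)\<rparr>)"
      using I l by (simp add: unchanged_def)
    show "nval (NSub eN (NReg 2)) s' = N - l" if "?J i s'" for i s' using that N by simp
    show "regs s' 2 = l \<and> ?I (Suc l) (s'\<lparr>regs := (regs s')(2 := Suc l)\<rparr>)" if "?J (N - l) s'" for s'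
      using that by (auto simp: unchanged_def less_Suc_eq)
    fix i s' assume J: "?J i s'" and i: "regs s' 3 = i" "i < N - l"
    have "wp \<delta> A w (\<lambda>s''. s'' = put c l i (f l i) s') s'"
      using J i l by (intro w) auto
    then show "wp \<delta> A w (\<lambda>s''. regs s'' 3 = i
        \<and> ?J (Suc i) (s''\<lparr>regs := (regs s'')(3 := Suc i)\<rparr>)) s'"
      by (rule wp_mono) (use J i in \<open>auto simp: unchanged_def less_Suc_eq fun_eq_iff\<close>)
  qed
qed

section \<open>The program\<close>

text \<open>Register 0 holds the input \<open>n\<close> and register 1 the index \<open>k\<close> of the next pair
  of coefficients; registers 2 to 4 are loop counters. The tables are: 0, the vectors
  \<open>krylov\<close> (the moments of \<open>\<sigma>\<close> form its column 0); 1, the moments of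
  \<open>\<mu>\<close>; 2, the current \<open>moment_triangle\<close>; 3, a single cell with the current
  power of \<open>\<delta>\<close>; 4, the table \<open>op_moment\<close> of \<open>\<mu>\<close>; 5, a single cell which
  becomes nonzero when the support of \<open>\<mu>\<close> is found to be exhausted.\<close>

abbreviation "row_reg \<equiv> NReg 2"
abbreviation "col_reg \<equiv> NReg 3"
abbreviation "order_reg \<equiv> NReg 4"
abbreviation "index_reg \<equiv> NReg 1"
abbreviation "minus_const e d \<equiv> NSub e (NConst d)"
abbreviation "plus_const e d \<equiv> NAdd e (NConst d)"
abbreviation "cell t \<equiv> RCell (NConst t)"

text \<open>The coefficients of index \<open>k\<close> depend on the moments of order at most
  \<open>2 * k + 1\<close>.\<close>

definition count_moments :: nexp where
  "count_moments = plus_const (NMul (NConst 2) index_reg) 2"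

definition krylov_entry :: com where
  "krylov_entry =
     (let inner = RAdd (RMul (REntry col_reg col_reg) (cell 0 (minus_const row_reg 1) col_reg))
                       (RMul (REntry col_reg (plus_const col_reg 1)) (cell 0 (minus_const row_reg 1) (plus_const col_reg 1)));
          left = RMul (REntry col_reg (minus_const col_reg 1)) (cell 0 (minus_const row_reg 1) (minus_const col_reg 1))
      in Cond (NLess (NConst 0) row_reg)
           (Cond (NLess (NConst 0) col_reg)
             (SetCell (NConst 0) row_reg col_reg (RAdd left inner))
             (SetCell (NConst 0) row_reg col_reg inner))
           (Cond (NLess (NConst 0) col_reg)
             (SetCell (NConst 0) row_reg col_reg RZero)
             (SetCell (NConst 0) row_reg col_reg ROne)))"

definition moment_triangle_entry :: com where
  "moment_triangle_entry =
     Cond (NLess (NConst 0) row_reg)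
       (SetCell (NConst 2) row_reg col_reg
         (RAdd (RMul RParam (cell 2 (minus_const row_reg 1) col_reg))
               (RMul (RSub ROne RParam) (cell 2 (minus_const row_reg 1) (plus_const col_reg 1)))))
       (SetCell (NConst 2) row_reg col_reg
         (RMul (cell 0 col_reg (NConst 0)) (cell 1 (NSub order_reg col_reg) (NConst 0))))"

definition next_moment :: com where
  "next_moment =
     Seq (SetCell (NConst 1) order_reg (NConst 0) ROne)
    (Seq (fill (plus_const order_reg 1) (plus_const order_reg 1) moment_triangle_entry)
    (Seq (SetCell (NConst 1) order_reg (NConst 0)
           (RAdd ROne (RDiv (RSub (cell 2 order_reg (NConst 0)) ROne)
                            (RSub ROne (cell 3 (NConst 0) (NConst 0))))))
         (SetCell (NConst 3) (NConst 0) (NConst 0) (RMul RParam (cell 3 (NConst 0) (NConst 0))))))"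

text \<open>The diagonal coefficient and the ratio of consecutive squared norms, read off the rows
  \<open>r\<close> and \<open>r - 1\<close> of the Chebyshev table as in \<open>mdiag_eq\<close> and
  \<open>op_moment_diag\<close>; the expression \<open>r\<close> has to evaluate to the shifted
  index \<open>k + 1\<close>.\<close>

definition diag_exp :: "nexp \<Rightarrow> rexp" where
  "diag_exp r = RSub (RDiv (cell 4 r r) (cell 4 r (minus_const r 1)))
                   (RDiv (cell 4 (minus_const r 1) (minus_const r 1)) (cell 4 (minus_const r 1) (minus_const r 2)))"

definition norm_ratio_exp :: "nexp \<Rightarrow> rexp" where
  "norm_ratio_exp r
      = RDiv (cell 4 r (minus_const r 1)) (cell 4 (minus_const r 1) (minus_const r 2))"

definition op_moment_entry :: com where
  "op_moment_entry =
     Cond (NLess (NConst 1) row_reg)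
       (SetCell (NConst 4) row_reg col_reg
         (RSub (RSub (cell 4 (minus_const row_reg 1) (plus_const col_reg 1))
                     (RMul (diag_exp (minus_const row_reg 1)) (cell 4 (minus_const row_reg 1) col_reg)))
               (RMul (norm_ratio_exp (minus_const row_reg 1)) (cell 4 (minus_const row_reg 2) col_reg))))
       (Cond (NLess (NConst 0) row_reg)
         (SetCell (NConst 4) row_reg col_reg (cell 1 col_reg (NConst 0)))
         (SetCell (NConst 4) row_reg col_reg RZero))"

definition tables :: com where
  "tables =
     Seq (fill count_moments count_moments krylov_entry)
    (Seq (SetCell (NConst 3) (NConst 0) (NConst 0) ROne)
    (Seq (For 4 count_moments next_moment)
         (fill (plus_const index_reg 2) (plus_const count_moments 1) op_moment_entry)))"

definition emit_entries :: com where
  "emit_entries =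
     Seq (Cond (NLess (NConst 0) index_reg) (Emit (RSqrt (norm_ratio_exp (plus_const index_reg 1)))) Skip)
    (Seq (Emit (diag_exp (plus_const index_reg 1)))
         (SetReg 1 (plus_const index_reg 1)))"

text \<open>All tables are recomputed from scratch in each round, which makes a round independent of
  what earlier rounds have left in memory. The cell tested is the squared norm of
  \<open>\<pi>\<^sub>k\<close>.\<close>

definition one_round :: com where
  "one_round =
     Seq tables
       (Cond (IsZero (cell 4 (plus_const index_reg 1) index_reg))
         (SetCell (NConst 5) (NConst 0) (NConst 0) ROne)
         emit_entries)"

text \<open>The guard \<open>g\<close> expresses which rounds are wanted: all of them, or only those with
  \<open>k < n\<close>.\<close>

definition jacobi_program :: "bexp \<Rightarrow> com" where
  "jacobi_program g = While (BAnd (IsZero (cell 5 (NConst 0) (NConst 0))) g) one_round"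

section \<open>Correctness of the tables\<close>

lemma wp_krylov_entry:
  assumes "regs s 2 = l" "regs s 3 = i" "i < N - l"
    and "\<And>l' i'. l' < l \<Longrightarrow> i' < N - l' \<Longrightarrow> cells s 0 l' i' = krylov (mentry A) l' i'"
  shows "wp \<delta> A krylov_entry (\<lambda>s'. s' = put 0 l i (krylov (mentry A) l i) s) s"
proof (cases l)
  case 0
  then show ?thesis
    unfolding krylov_entry_def Let_def using assms
    by (intro wp_CondF[of _ _ "NLess (NConst 0) row_reg"] wp_Cond) (auto intro!: wp_put)
next
  case (Suc l')
  then show ?thesis
    unfolding krylov_entry_def Let_def using assms
    by (intro wp_CondT[of _ _
        "NLess (NConst 0) row_reg"] wp_Cond) (auto intro!: wp_put simp: add.assoc)
qed

context affine_ifs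
begin

lemma wp_moment_triangle_entry:
  assumes "regs s 2 = l" "regs s 3 = i" "regs s 4 = L" "i < Suc L - l"
    and sig: "\<And>j. j \<le> L \<Longrightarrow> cells s 0 j 0 = sigma.moment j"
    and mus: "\<And>j. j < L \<Longrightarrow> cells s 1 j 0 = mu.moment j" "cells s 1 L 0 = 1"
    and prev: "\<And>l' i'. l' < l \<Longrightarrow> i' < Suc L - l' \<Longrightarrow> cells s 2 l' i' = moment_triangle L l' i'"
  shows "wp \<delta> A moment_triangle_entry (\<lambda>s'. s' = put 2 l i (moment_triangle L l i) s) s"
proof (cases l)
  case 0
  have "cells s 0 i 0 * cells s 1 (L - i) 0 = moment_triangle L 0 i"
    using assms 0 by (subst moment_triangle_0) auto
  then show ?thesis
    unfolding moment_triangle_entry_def using assms 0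
    by (intro wp_CondF wp_put) auto
next
  case (Suc l')
  have "\<delta> * cells s 2 l' i + (1 - \<delta>) * cells s 2 l' (Suc i) = moment_triangle L (Suc l') i"
    using assms Suc by (subst moment_triangle_Suc) auto
  then show ?thesis
    unfolding moment_triangle_entry_def using assms Suc
    by (intro wp_CondT wp_put) auto
qed

lemma wp_next_moment:
  assumes L: "regs s 4 = L"
    and sig: "\<And>j. j \<le> L \<Longrightarrow> cells s 0 j 0 = sigma.moment j"
    and mus: "\<And>j. j < L \<Longrightarrow> cells s 1 j 0 = mu.moment j"
    and pow: "cells s 3 0 0 = \<delta> ^ L"
  shows "wp \<delta> A next_moment (\<lambda>s'. unchanged {2,3} {1,2,3} s s' \<and>
           (\<forall>j\<le>L. cells s' 1 j 0 = mu.moment j) \<and> cells s' 3 0 0 = \<delta> ^ Suc L) s"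
  unfolding next_moment_def
proof (intro wp_Seq wp_put)
  let ?s = "put 1 (nval order_reg s) (nval (NConst 0) s) (rval \<delta> A ROne s) s"
  show "wp \<delta> A (fill (plus_const order_reg 1) (plus_const order_reg 1) moment_triangle_entry)
     (wp \<delta> A (Seq (SetCell (NConst 1) order_reg (NConst 0)
           (RAdd ROne (RDiv (RSub (cell 2 order_reg (NConst 0)) ROne)
                            (RSub ROne (cell 3 (NConst 0) (NConst 0))))))
         (SetCell (NConst 3) (NConst 0) (NConst 0) (RMul RParam (cell 3 (NConst 0) (NConst 0)))))
       (\<lambda>s'. unchanged {2,3} {1,2,3} s s' \<and>
           (\<forall>j\<le>L. cells s' 1 j 0 = mu.moment j) \<and> cells s' 3 0 0 = \<delta> ^ Suc L)) ?s"
  proof (rule wp_fill[where f = "moment_triangle L" and c = 2 and R = "Suc L" and N = "Suc L"])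
    fix s' l i
    assume u: "unchanged {2,3} {2} ?s s'" and "regs s' 2 = l" "regs s' 3 = i" "l < Suc L"
        "i < Suc L - l"
      and "\<And>l' i'. l' < l \<Longrightarrow> i' < Suc L - l' \<Longrightarrow> cells s' 2 l' i' = moment_triangle L l' i'"
    then show "wp \<delta> A moment_triangle_entry (\<lambda>s''. s'' = put 2 l i (moment_triangle L l i) s') s'"
      using L sig mus by (intro wp_moment_triangle_entry) (auto simp: unchanged_def)
  next
    fix s' assume u: "unchanged {2,3} {2} ?s s'" and t: "\<And>l i. l < Suc L \<Longrightarrow> i < Suc L - l
        \<Longrightarrow> cells s' 2 l i = moment_triangle L l i"
    have "cells s' 2 L 0 = moment_triangle L L 0"
      using t[of L 0] by simp
    then have "1 + (cells s' 2 L 0 - 1) / (1 - cells s' 3 0 0) = mu.moment L"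
      using moment_triangle_top[of L] u pow by (simp add: unchanged_def)
    then show "wp \<delta> A (Seq (SetCell (NConst 1) order_reg (NConst 0)
           (RAdd ROne (RDiv (RSub (cell 2 order_reg (NConst 0)) ROne)
                            (RSub ROne (cell 3 (NConst 0) (NConst 0))))))
         (SetCell (NConst 3) (NConst 0) (NConst 0) (RMul RParam (cell 3 (NConst 0) (NConst 0)))))
       (\<lambda>s'. unchanged {2,3} {1,2,3} s s' \<and>
           (\<forall>j\<le>L. cells s' 1 j 0 = mu.moment j) \<and> cells s' 3 0 0 = \<delta> ^ Suc L) s'"
      using u L mus pow by (intro wp_Seq wp_put) (auto simp: unchanged_def fun_eq_iff)
  qed (use L in \<open>auto simp: unchanged_def\<close>)
qed

lemma wp_op_moment_entry:
  assumes "regs s 2 = l" "regs s 3 = i" "l < k + 2" "i < 2 * k + 3 - l" "enat k \<le> supp_card \<mu>"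
    and mus: "\<And>j. j < 2 * k + 2 \<Longrightarrow> cells s 1 j 0 = mu.moment j"
    and prev: "\<And>l' i'. l' < l \<Longrightarrow> i' < 2 * k + 3 - l' \<Longrightarrow> cells s 4 l' i' = mu.op_moment l' i'"
  shows "wp \<delta> A op_moment_entry (\<lambda>s'. s' = put 4 l i (mu.op_moment l i) s) s"
proof -
  consider "l = 0" | "l = 1" | r where "l = Suc (Suc r)"
    by (metis One_nat_def not0_implies_Suc)
  then show ?thesis
  proof cases
    case 1
    then show ?thesis
      unfolding op_moment_entry_def using assms mu.op_moment_0 by (intro wp_CondF wp_put) auto
  next
    case 2
    then show ?thesis
      unfolding op_moment_entry_def using assms mu.op_moment_1
      by (intro wp_CondF[of _ _ "NLess (NConst 1) row_reg"] wp_CondT wp_put) auto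
  next
    case 3
    have r: "enat r < supp_card \<mu>"
      using assms(3,5) 3 by (metis Suc_eq_plus1 add_2_eq_Suc' enat_ord_simps(2) not_less_eq order_less_le_trans)
    have c: "cells s 4 (Suc r) (Suc i) = mu.op_moment (Suc r) (Suc i)" "cells s 4 (Suc r) i
        = mu.op_moment (Suc r) i"
      "cells s 4 r i = mu.op_moment r i" "cells s 4 (Suc r) (Suc r) = mu.op_moment (Suc r) (Suc r)"
      "cells s 4 (Suc r) r = mu.op_moment (Suc r) r" "cells s 4 r r = mu.op_moment r r"
      "cells s 4 r (r - Suc 0) = mu.op_moment r (r - Suc 0)"
      using 3 assms by (auto intro!: prev)
    have n: "r - 1 = r - Suc 0" by simp
    show ?thesis
      unfolding op_moment_entry_def diag_exp_def norm_ratio_exp_def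
      using assms 3 c mu.op_moment_rec[OF r, of i]
      by (intro wp_CondT wp_put) (auto simp: numeral_eq_Suc)
  qed
qed

text \<open>The premise on \<open>A\<close> concerns only the moments of order below \<open>2 * k + 2\<close>, so
  that the lemma applies to the full matrix as well as to any truncation of size greater than
  \<open>k\<close>. The case \<open>k = supp_card \<mu>\<close> is included because it is the round in which
  the program detects the end.\<close>

lemma wp_tables:
  assumes k: "regs s 1 = k" "enat k \<le> supp_card \<mu>"
    and A: "\<And>l. l < 2 * k + 2 \<Longrightarrow> krylov (mentry A) l 0 = sigma.moment l"
    and Q: "\<And>s'. unchanged {2,3,4} {0,1,2,3,4} s s' \<Longrightarrow>
       (\<And>r i. r < k + 2 \<Longrightarrow> i < 2 * k + 3 - r \<Longrightarrow> cells s' 4 r i = mu.op_moment r i) \<Longrightarrow> Q s'"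
  shows "wp \<delta> A tables Q s"
  unfolding tables_def
proof (rule wp_Seq, rule wp_fill[where f = "krylov (mentry A)" and c = 0
      and R = "2 * k + 2" and N = "2 * k + 2"])
  fix s' :: state and l i assume "regs s' 2 = l" "regs s' 3 = i" "i < 2 * k + 2 - l"
    "\<And>l' i'. l' < l \<Longrightarrow> i' < 2 * k + 2 - l' \<Longrightarrow> cells s' 0 l' i' = krylov (mentry A) l' i'"
  then show "wp \<delta> A krylov_entry (\<lambda>s''. s'' = put 0 l i (krylov (mentry A) l i) s') s'"
    by (rule wp_krylov_entry)
next
  fix s1 assume u1: "unchanged {2,3} {0} s s1"
    and s1: "\<And>l i. l < 2 * k + 2 \<Longrightarrow> i < 2 * k + 2 - l \<Longrightarrow> cells s1 0 l i = krylov (mentry A) l i"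
  let ?I = "\<lambda>L s'. unchanged {2,3,4} {0,1,2,3,4} s s'
      \<and> (\<forall>j<2 * k + 2. cells s' 0 j 0 = sigma.moment j)
      \<and> (\<forall>j<L. cells s' 1 j 0 = mu.moment j) \<and> cells s' 3 0 0 = \<delta> ^ L"
  show "wp \<delta> A (Seq (SetCell (NConst 3) (NConst 0) (NConst 0) ROne)
       (Seq (For 4 count_moments next_moment)
         (fill (plus_const index_reg 2) (plus_const count_moments 1) op_moment_entry))) Q s1"
  proof (intro wp_Seq wp_put, rule wp_For[where I = ?I and n = "2 * k + 2"])
    let ?s = "put 3 (nval (NConst 0) s1) (nval (NConst 0) s1) (rval \<delta> A ROne s1) s1"
    show "?I 0 (?s\<lparr>regs := (regs ?s)(4 := 0)\<rparr>)"
      using u1 s1 A by (auto simp: unchanged_def fun_eq_iff)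
    show "nval count_moments s' = 2 * k + 2" if "?I L s'" for L s'
      using that k by (simp add: count_moments_def unchanged_def)
    show "wp \<delta> A next_moment (\<lambda>s''. regs s'' 4 = L
        \<and> ?I (Suc L) (s''\<lparr>regs := (regs s'')(4 := Suc L)\<rparr>)) s'"
      if I: "?I L s'" and L: "regs s' 4 = L" "L < 2 * k + 2" for L s'
    proof -
      have "wp \<delta> A next_moment (\<lambda>s''. unchanged {2,3} {1,2,3} s' s'' \<and>
           (\<forall>j\<le>L. cells s'' 1 j 0 = mu.moment j) \<and> cells s'' 3 0 0 = \<delta> ^ Suc L) s'"
        using I L by (intro wp_next_moment) auto
      then show ?thesis
        by (rule wp_mono) (use I L in \<open>auto simp: unchanged_def less_Suc_eq_le\<close>)
    qed
    show "wp \<delta> A (fill (plus_const index_reg 2) (plus_const count_moments 1) op_moment_entry) Q s2"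
      if I: "?I (2 * k + 2) s2" for s2
    proof (rule wp_fill[where f = mu.op_moment and c = 4 and R = "k + 2" and N = "2 * k + 3"])
      fix s' l i
      assume u: "unchanged {2,3} {4} s2 s'" and "regs s' 2 = l" "regs s' 3 = i" "l < k + 2"
          "i < 2 * k + 3 - l"
        and "\<And>l' i'. l' < l \<Longrightarrow> i' < 2 * k + 3 - l' \<Longrightarrow> cells s' 4 l' i' = mu.op_moment l' i'"
      then show "wp \<delta> A op_moment_entry (\<lambda>s''. s'' = put 4 l i (mu.op_moment l i) s') s'"
        using I k by (intro wp_op_moment_entry) (auto simp: unchanged_def)
    next
      fix s' assume "unchanged {2,3} {4} s2 s'"
        "\<And>l i. l < k + 2 \<Longrightarrow> i < 2 * k + 3 - l \<Longrightarrow> cells s' 4 l i = mu.op_moment l i"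
      then show "Q s'"
        using I by (intro Q) (auto simp: unchanged_def)
    qed (use I k in \<open>auto simp: unchanged_def count_moments_def\<close>)
  qed
qed (use k in \<open>auto simp: unchanged_def count_moments_def\<close>)

end

section \<open>Correctness of the program\<close>

lemma step_outputs: "\<exists>vs. length vs \<le> 1 \<and> outputs (snd (step \<delta> A (c, s))) = outputs s @ vs"
proof (induction c arbitrary: s)
  case (Seq c d)
  obtain c' s' where "step \<delta> A (c, s) = (c', s')" by fastforce
  then show ?case using Seq(1)[of s] by auto
qed auto

lemma run_Suc: "run P n \<delta> A (Suc t) = step \<delta> A (run P n \<delta> A t)"
  by (simp add: run_def)

text \<open>The output grows by at most one entry per step and is never revised. Therefore every initial
  part of what has been output at some time was the complete output at an earlier time, even though
  a round emits two entries.\<close>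

lemma run_take:
  assumes "j \<le> length (outputs (snd (run P n \<delta> A t)))"
  shows "\<exists>t'. outputs (snd (run P n \<delta> A t')) = take j (outputs (snd (run P n \<delta> A t)))"
  using assms
proof (induction t)
  case 0
  then show ?case by (intro exI[of _ 0]) (simp add: run_def init_state_def)
next
  case (Suc t)
  obtain vs where vs: "length vs \<le> 1"
    "outputs (snd (run P n \<delta> A (Suc t))) = outputs (snd (run P n \<delta> A t)) @ vs"
    using step_outputs[of \<delta> A "fst (run P n \<delta> A t)" "snd (run P n \<delta> A t)"] by (auto simp: run_Suc)
  show ?case
  proof (cases "j \<le> length (outputs (snd (run P n \<delta> A t)))")
    case True
    with Suc vs show ?thesis by simp
  next
    case False
    with Suc.prems vs have "j = length (outputs (snd (run P n \<delta> A (Suc t))))" by simp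
    then show ?thesis by (intro exI[of _ "Suc t"]) simp
  qed
qed

lemma reaches_run:
  "reaches \<delta> A (P, init_state n) (c, s) \<longleftrightarrow> (\<exists>t. run P n \<delta> A t = (c, s))"
  by (simp add: reaches_def run_def)

context affine_ifs
begin

text \<open>What round \<open>k\<close> requires of the input \<open>A\<close> and of the expected output
  \<open>B\<close>, in a form that covers both the full and the truncated matrices.\<close>

definition entries_ok :: "sq_matrix \<Rightarrow> sq_matrix \<Rightarrow> nat \<Rightarrow> bool" where
  "entries_ok A B k \<longleftrightarrow>
     (\<forall>l<2 * k + 2. krylov (mentry A) l 0 = sigma.moment l) \<and>
     mentry B k k = mu.diag_coeff k \<and> (0 < k \<longrightarrow> mentry B k (k - 1) = mu.off_coeff k)"

text \<open>Before round \<open>k\<close> the coefficients of index below \<open>k\<close> have been emitted.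
  These are \<open>2 * k - 1\<close> entries, which is 0 for \<open>k = 0\<close> because subtraction is
  truncated.\<close>

definition loop_inv :: "nat \<Rightarrow> sq_matrix \<Rightarrow> nat \<Rightarrow> state \<Rightarrow> bool" where
  "loop_inv n B k s \<longleftrightarrow> regs s 0 = n \<and> regs s 1 = k \<and> cells s 5 0 0 = 0 \<and>
     outputs s = map (jacobi_entry B) [0..<2 * k - 1]"

lemma wp_one_round_continue:
  assumes invariant: "loop_inv n B k s" and k: "enat k < supp_card \<mu>"
    and ok: "entries_ok A B k"
  shows "wp \<delta> A one_round (loop_inv n B (Suc k)) s"
  unfolding one_round_def
proof (rule wp_Seq, rule wp_tables[where k = k])
  show "regs s 1 = k" using invariant by (simp add: loop_inv_def)
  show "enat k \<le> supp_card \<mu>" using k by simp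
  show "\<And>l. l < 2 * k + 2 \<Longrightarrow> krylov (mentry A) l 0 = sigma.moment l"
    using ok by (simp add: entries_ok_def)
next
  fix s' assume u: "unchanged {2,3,4} {0,1,2,3,4} s s'"
    and t: "\<And>r i. r < k + 2 \<Longrightarrow> i < 2 * k + 3 - r \<Longrightarrow> cells s' 4 r i = mu.op_moment r i"
  have k': "enat k \<le> supp_card \<mu>" using k by simp
  have r: "regs s' 1 = k" "regs s' 0 = n" "cells s' 5 0 0 = 0"
    "outputs s' = map (jacobi_entry B) [0..<2 * k - 1]"
    using u invariant by (auto simp: unchanged_def loop_inv_def)
  have c: "cells s' 4 (Suc k) k = mu.mnorm (Suc k)"
    "cells s' 4 (Suc k) (Suc k) = mu.op_moment (Suc k) (Suc k)"
    "cells s' 4 k k = mu.op_moment k k" "cells s' 4 k (k - Suc 0) = mu.mnorm k"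
    using t[of "Suc k" k] t[of "Suc k" "Suc k"] t[of k k] t[of k "k - 1"]
      mu.op_moment_diag[OF k'] mu.op_moment_diag'[OF k']
    by auto
  have h: "mu.mnorm (Suc k) > 0" by (rule mu.mnorm_pos[OF k])
  have a: "rval \<delta> A (diag_exp (plus_const index_reg 1)) s' = mentry B k k"
    using ok mu.mdiag_eq[OF k] mu.op_moment_diag[OF k'] mu.op_moment_diag'[OF k'] c r k
    by (simp add: diag_exp_def entries_ok_def mu.diag_coeff_def numeral_eq_Suc)
  have b: "sqrt (rval \<delta> A (norm_ratio_exp (plus_const index_reg 1)) s') = mentry B k (k - 1)"
    if "0 < k"
    using that ok c r k
    by (simp add: norm_ratio_exp_def entries_ok_def mu.off_coeff_def numeral_eq_Suc)
  have upt: "[0..<Suc (2 * k)] = [0..<2 * k - 1] @ (if 0 < k then [2 * k - 1] else []) @ [2 * k]"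
    by (cases k) auto
  have out: "map (jacobi_entry B) [0..<2 * Suc k - 1] = map (jacobi_entry B) [0..<2 * k - 1]
      @ (if 0 < k then [mentry B k (k - 1)] else []) @ [mentry B k k]"
  proof -
    have "2 * Suc k - 1 = Suc (2 * k)" by simp
    moreover have "jacobi_entry B (2 * k) = mentry B k k" by (simp add: jacobi_entry_def)
    moreover have "jacobi_entry B (2 * k - 1) = mentry B k (k - 1)" if "0 < k"
      using that by (cases k) (simp_all add: jacobi_entry_def)
    ultimately show ?thesis by (simp only: upt) simp
  qed
  show "wp \<delta> A (Cond (IsZero (cell 4 (plus_const index_reg 1) index_reg))
         (SetCell (NConst 5) (NConst 0) (NConst 0) ROne) emit_entries) (loop_inv n B (Suc k)) s'"
  proof (rule wp_CondF)
    show "\<not> bval \<delta> A (IsZero (cell 4 (plus_const index_reg 1) index_reg)) s'"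
      using c r h by simp
    let ?s = "\<lambda>vs. s'\<lparr>outputs := outputs s' @ vs\<rparr>"
    have rv: "rval \<delta> A (diag_exp (plus_const index_reg 1)) (?s vs)
        = rval \<delta> A (diag_exp (plus_const index_reg 1)) s'" for vs
      by (simp add: diag_exp_def)
    \<comment> \<open>The first entry of the pair exists only for \<open>k > 0\<close>.\<close>
    have "wp \<delta> A (Cond (NLess (NConst 0) index_reg) (Emit (RSqrt (norm_ratio_exp (plus_const index_reg 1)))) Skip)
       (\<lambda>s''. s'' = ?s (if 0 < k then [mentry B k (k - 1)] else [])) s'"
      using r b by (intro wp_Cond) (auto intro!: wp_Emit wp_Skip)
    moreover have
        "wp \<delta> A (Seq (Emit (diag_exp (plus_const index_reg 1))) (SetReg 1 (plus_const index_reg 1)))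
       (loop_inv n B (Suc k)) (?s (if 0 < k then [mentry B k (k - 1)] else []))"
      by (intro wp_Seq wp_Emit wp_SetReg, unfold rv a loop_inv_def out) (use r in simp)
    ultimately show "wp \<delta> A emit_entries (loop_inv n B (Suc k)) s'"
      unfolding emit_entries_def by (intro wp_Seq) (auto elim!: wp_mono)
  qed
qed

lemma wp_one_round_stop:
  assumes invariant: "loop_inv n B k s" and k: "supp_card \<mu> = enat k"
    and ok: "\<And>l. l < 2 * k + 2 \<Longrightarrow> krylov (mentry A) l 0 = sigma.moment l"
  shows "wp \<delta> A one_round (\<lambda>s'. cells s' 5 0 0 = 1
      \<and> outputs s' = map (jacobi_entry B) [0..<2 * k - 1]) s"
  unfolding one_round_def
proof (rule wp_Seq, rule wp_tables[where k = k])
  show "regs s 1 = k" using invariant by (simp add: loop_inv_def)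
  show "enat k \<le> supp_card \<mu>" using k by simp
next
  fix s' assume u: "unchanged {2,3,4} {0,1,2,3,4} s s'"
    and t: "\<And>r i. r < k + 2 \<Longrightarrow> i < 2 * k + 3 - r \<Longrightarrow> cells s' 4 r i = mu.op_moment r i"
  have "cells s' 4 (Suc k) k = 0"
    using t[of "Suc k" k] mu.op_moment_diag[of k] mu.mnorm_eq_0(1)[OF k] k by auto
  then show "wp \<delta> A (Cond (IsZero (cell 4 (plus_const index_reg 1) index_reg))
         (SetCell (NConst 5) (NConst 0) (NConst 0) ROne) emit_entries)
       (\<lambda>s'. cells s' 5 0 0 = 1 \<and> outputs s' = map (jacobi_entry B) [0..<2 * k - 1]) s'"
    using u invariant by (intro wp_CondT wp_put) (auto simp: unchanged_def loop_inv_def)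
qed (rule ok)

lemma program_reaches:
  assumes "\<And>k. k < K \<Longrightarrow> enat k < supp_card \<mu> \<and> entries_ok A B k"
    and g: "\<And>k s. k < K \<Longrightarrow> loop_inv n B k s \<Longrightarrow> bval \<delta> A g s"
  shows "\<exists>s. reaches \<delta> A (jacobi_program g, init_state n) (jacobi_program g, s) \<and> loop_inv n B K s"
  using assms
proof (induction K)
  case 0
  have "loop_inv n B 0 (init_state n)"
    by (simp add: loop_inv_def init_state_def)
  then show ?case using reaches_refl by blast
next
  case (Suc K)
  then obtain s where s: "reaches \<delta> A (jacobi_program g, init_state n) (jacobi_program g, s)"
      "loop_inv n B K s"
    by (metis less_Suc_eq)
  obtain s' where s': "reaches \<delta> A (one_round, s) (Skip, s')" "loop_inv n B (Suc K) s'"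
    using wp_one_round_continue[OF s(2)] Suc.prems unfolding wp_def by (metis lessI)
  have "bval \<delta> A (BAnd (IsZero (cell 5 (NConst 0) (NConst 0))) g) s"
    using Suc.prems(2)[OF lessI s(2)] s(2) by (simp add: loop_inv_def)
  then have "reaches \<delta> A (jacobi_program g, s) (jacobi_program g, s')"
    using reaches_Seq[OF s'(1)] unfolding jacobi_program_def
    by (intro reaches_step[of _ _ "(While _ _, s)"]) simp
  then show ?case
    using s s' reaches_trans by blast
qed

text \<open>There are two ways to stop after \<open>K\<close> productive rounds: the guard fails, or one more
  round finds the squared norm of \<open>\<pi>\<^sub>K\<close> to be zero.\<close>

lemma program_halts:
  assumes loop: "\<And>k. k < K \<Longrightarrow> enat k < supp_card \<mu> \<and> entries_ok A B k"
    and g: "\<And>k s. k < K \<Longrightarrow> loop_inv n B k s \<Longrightarrow> bval \<delta> A g s"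
    and stop: "(\<forall>s. loop_inv n B K s \<longrightarrow> \<not> bval \<delta> A g s) \<or>
      supp_card \<mu> = enat K \<and> (\<forall>l<2 * K + 2. krylov (mentry A) l 0 = sigma.moment l)
        \<and> (\<forall>s. loop_inv n B K s \<longrightarrow> bval \<delta> A g s)"
  shows "\<exists>t. fst (run (jacobi_program g) n \<delta> A t) = Skip \<and>
             outputs (snd (run (jacobi_program g) n \<delta> A t)) = map (jacobi_entry B) [0..<2 * K - 1]"
proof -
  obtain s where s: "reaches \<delta> A (jacobi_program g, init_state n) (jacobi_program g, s)"
      "loop_inv n B K s"
    using program_reaches[of K A B n g] loop g by blast
  have "wp \<delta> A (jacobi_program g) (\<lambda>s. outputs s = map (jacobi_entry B) [0..<2 * K - 1]) s"
    using stop
  proof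
    assume "\<forall>s. loop_inv n B K s \<longrightarrow> \<not> bval \<delta> A g s"
    then show ?thesis
      unfolding jacobi_program_def using s(2) by (intro wp_While_end) (auto simp: loop_inv_def)
  next
    assume st: "supp_card \<mu> = enat K \<and> (\<forall>l<2 * K + 2. krylov (mentry A) l 0 = sigma.moment l)
        \<and> (\<forall>s. loop_inv n B K s \<longrightarrow> bval \<delta> A g s)"
    have "wp \<delta> A one_round (\<lambda>s'. cells s' 5 0 0 = 1
        \<and> outputs s' = map (jacobi_entry B) [0..<2 * K - 1]) s"
      using st by (intro wp_one_round_stop[OF s(2)]) auto
    then show ?thesis
      unfolding jacobi_program_def using s(2) st
      by (intro wp_While_step) (auto simp: loop_inv_def intro!: wp_While_end elim!: wp_mono)
  qed
  then obtain s' where "reaches \<delta> A (jacobi_program g, s) (Skip, s')"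
      "outputs s' = map (jacobi_entry B) [0..<2 * K - 1]"
    unfolding wp_def by blast
  with reaches_trans[OF s(1) this(1)] show ?thesis
    unfolding reaches_run by (metis fst_conv snd_conv)
qed

lemma jacobi_entries:
  assumes "enat k < supp_card \<mu>"
  shows "mentry (jacobi_matrix \<mu>) k k = mu.diag_coeff k"
    and "0 < k \<Longrightarrow> mentry (jacobi_matrix \<mu>) k (k - 1) = mu.off_coeff k"
proof -
  have "enat (k - 1) < supp_card \<mu>"
    using assms by (metis diff_le_self enat_ord_simps(1) order_le_less_trans)
  then show "mentry (jacobi_matrix \<mu>) k k = mu.diag_coeff k"
    and "0 < k \<Longrightarrow> mentry (jacobi_matrix \<mu>) k (k - 1) = mu.off_coeff k"
    using assms by (auto simp: jacobi_matrix_def mu.jacobi_a_eq mu.jacobi_b_eq)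
qed

lemma outputs_full:
  "outputs_matrix (jacobi_program (IsZero RZero)) 0 \<delta> (jacobi_matrix \<sigma>) (jacobi_matrix \<mu>)"
proof -
  let ?P = "jacobi_program (IsZero RZero)" and ?A = "jacobi_matrix \<sigma>" and ?B = "jacobi_matrix \<mu>"
  have ok: "entries_ok ?A ?B k" if "enat k < supp_card \<mu>" for k
    using jacobi_entries[OF that] by (simp add: entries_ok_def sigma.moment_krylov)
  have ms: "msize ?B = supp_card \<mu>" by (simp add: jacobi_matrix_def)
  show ?thesis
  proof (cases "supp_card \<mu>")
    case (enat m)
    have "\<exists>t. fst (run ?P 0 \<delta> ?A t) = Skip \<and>
             outputs (snd (run ?P 0 \<delta> ?A t)) = map (jacobi_entry ?B) [0..<2 * m - 1]"
      by (rule program_halts) (use enat ok sigma.moment_krylov in auto)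
    then show ?thesis
      by (simp add: outputs_matrix_def ms enat)
  next
    case infinity
    have "\<exists>t. outputs (snd (run ?P 0 \<delta> ?A t)) = map (jacobi_entry ?B) [0..<j]" for j
    proof -
      obtain s where "reaches \<delta> ?A (?P, init_state 0) (?P, s)" "loop_inv 0 ?B (Suc j) s"
        using program_reaches[of "Suc j" ?A ?B 0 "IsZero RZero"] infinity ok by auto
      then obtain t where t: "outputs (snd (run ?P 0 \<delta> ?A t))
          = map (jacobi_entry ?B) [0..<2 * Suc j - 1]"
        unfolding reaches_run loop_inv_def by (metis snd_conv)
      obtain t' where "outputs (snd (run ?P 0 \<delta> ?A t')) = take j (outputs (snd (run ?P 0 \<delta> ?A t)))"
        using run_take[of j ?P 0 \<delta> ?A t] t by auto
      also have "\<dots> = map (jacobi_entry ?B) [0..<j]"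
        unfolding t by (simp add: take_map)
      finally show ?thesis by blast
    qed
    then show ?thesis
      by (simp add: outputs_matrix_def ms infinity)
  qed
qed

text \<open>The guard ends the loop before a round could ask for moments of order \<open>2 * n\<close> or above,
  which the truncation does not determine.\<close>

lemma outputs_truncated:
  "outputs_matrix (jacobi_program (NLess index_reg (NReg 0))) n \<delta>
     (truncate_matrix n (jacobi_matrix \<sigma>)) (truncate_matrix n (jacobi_matrix \<mu>))"
proof -
  let ?P = "jacobi_program (NLess index_reg (NReg 0))"
    and ?A = "truncate_matrix n (jacobi_matrix \<sigma>)" and ?B = "truncate_matrix n (jacobi_matrix \<mu>)"
  have mom: "krylov (mentry ?A) l 0 = sigma.moment l" if "l < 2 * n" for l
    using that krylov_truncate[of l 0 n] by (simp add: sigma.moment_krylov)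
  have ok: "entries_ok ?A ?B k" if "enat k < supp_card \<mu>" "k < n" for k
    using jacobi_entries[OF that(1)] mom that(2) by (auto simp: entries_ok_def truncate_matrix_def)
  obtain m where m: "min (enat n) (supp_card \<mu>) = enat m"
    by (metis enat_ord_code(4) infinity_ileE min.cobounded1 not_infinity_eq)
  then have lt: "enat k < supp_card \<mu>" "k < n" if "k < m" for k
    using that by (cases "supp_card \<mu>"; auto simp: min_def split: if_splits)+
  have stop: "m = n \<or> supp_card \<mu> = enat m \<and> m < n"
    using m by (cases "supp_card \<mu>") (auto simp: min_def split: if_splits)
  have "\<exists>t. fst (run ?P n \<delta> ?A t) = Skip \<and>
             outputs (snd (run ?P n \<delta> ?A t)) = map (jacobi_entry ?B) [0..<2 * m - 1]"
    by (rule program_halts) (use ok lt stop mom in \<open>auto simp: loop_inv_def\<close>)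
  moreover have "msize ?B = enat m"
    using m by (simp add: truncate_matrix_def jacobi_matrix_def)
  ultimately show ?thesis
    by (simp add: outputs_matrix_def)
qed

end

theorem theorem2:
  shows "(\<exists>P. \<forall>\<delta> \<sigma> \<mu>.
            0 \<le> \<delta> \<longrightarrow> \<delta> < 1 \<longrightarrow> \<sigma> \<in> prob_measures_on {-1..1} \<longrightarrow> ifs_invariant \<delta> \<sigma> \<mu> \<longrightarrow>
            outputs_matrix P 0 \<delta> (jacobi_matrix \<sigma>) (jacobi_matrix \<mu>)) \<and>
         (\<exists>Q. \<forall>n \<delta> \<sigma> \<mu>.
            1 \<le> n \<longrightarrow>
            0 \<le> \<delta> \<longrightarrow> \<delta> < 1 \<longrightarrow> \<sigma> \<in> prob_measures_on {-1..1} \<longrightarrow> ifs_invariant \<delta> \<sigma> \<mu> \<longrightarrow>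
            outputs_matrix Q n \<delta>
              (truncate_matrix n (jacobi_matrix \<sigma>)) (truncate_matrix n (jacobi_matrix \<mu>)))"
proof (intro conjI exI allI impI)
  fix \<delta> \<sigma> \<mu>
  assume "0 \<le> \<delta>" "\<delta> < 1" "\<sigma> \<in> prob_measures_on {-1..1}" "ifs_invariant \<delta> \<sigma> \<mu>"
  then interpret affine_ifs \<delta> \<sigma> \<mu> by unfold_locales
  show "outputs_matrix (jacobi_program (IsZero RZero)) 0 \<delta> (jacobi_matrix \<sigma>) (jacobi_matrix \<mu>)"
    by (rule outputs_full)
  show "outputs_matrix (jacobi_program (NLess index_reg (NReg 0))) n \<delta>
     (truncate_matrix n (jacobi_matrix \<sigma>)) (truncate_matrix n (jacobi_matrix \<mu>))" for n
    by (rule outputs_truncated)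
qed

end
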